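(* Let $0<\alpha\leq 1$ and $f\in\mathcal{D}$, where $\mathcal{D}$ is the Dirichlet space. Then the following are equivalent: (a) $\|r_t(f)-f\|_{\mathcal{D}}=O(|t|^{\alpha})$ as $t\to 0$; (b) $D(r,f')=O\left((1-r)^{\alpha-1}\right)$ as $r\to 1^{-}$; (c) $\|f_r-f\|_{\mathcal{D}}=O\left((1-r)^{\alpha}\right)$ as $r\to 1^{-}$.
   Context: $\mathbb{D}$ is the open unit disc in $\mathbb{C}$ and $dm(z)=\frac{1}{\pi}\rho\,d\theta\,d\rho$ (with $z=\rho e^{i\theta}$) is the normalized Lebesgue area measure on $\mathbb{D}$. The Bergman space $A^2$ consists of the analytic $g:\mathbb{D}\to\mathbb{C}$ with $\|g\|_{A^2}=\left(\int_{\mathbb{D}}|g(z)|^2\,dm(z)\right)^{1/2}<\infty$. The Dirichlet space $\mathcal{D}$ consists of the analytic $f:\mathbb{D}\to\mathbb{C}$ with $f'\in A^2$, with norm $\|f\|_{\mathcal{D}}=\left(|f(0)|^2+\|f'\|_{A^2}^2\right)^{1/2}$. For $f$ analytic on $\mathbb{D}$: the rotations are $r_t(f)(z)=f(e^{it}z)$, $t\in\mathbb{R}$; the dilations are $f_r(z)=f(rz)$, $0\leq r<1$; and $D(r,f)=\|f_r\|_{\mathcal{D}}$ for $0<r<1$. Thus $D(r,f')=\|(f')_r\|_{\mathcal{D}}$, where $(f')_r(z)=f'(rz)$. *)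

theory Defs
  imports "HOL-Complex_Analysis.Complex_Analysis" "HOL-Library.Landau_Symbols"
begin

text \<open>
  Functions on the unit disc are represented by functions of type complex to complex; only their
  values on the disc matter. The area measure therefore has the disc itself as its space, so that
  measurability of a function is not affected by its values outside the disc.
\<close>

abbreviation unit_disc :: "complex set" where
  "unit_disc \<equiv> ball 0 1"

definition disc_area :: "complex measure" where
  "disc_area = density (restrict_space lborel unit_disc) (\<lambda>_. ennreal (1 / pi))"

lemma space_disc_area [simp]: "space disc_area = unit_disc"
  by (simp add: disc_area_def space_restrict_space)

lemma emeasure_disc_area_unit_disc: "emeasure disc_area unit_disc = 1"
proof -
  have "emeasure lborel unit_disc = ennreal pi"
    using emeasure_ball[of 1 "0::complex"] by (simp add: unit_ball_vol_2)
  then have "emeasure (restrict_space lborel unit_disc) unit_disc = ennreal pi"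
    by (simp add: emeasure_restrict_space)
  moreover have "unit_disc \<in> sets (restrict_space lborel unit_disc)"
    using sets.top[of "restrict_space lborel unit_disc"] by (simp add: space_restrict_space)
  ultimately show ?thesis
    by (simp add: disc_area_def emeasure_density_const ennreal_mult[symmetric])
qed

definition bergman_space :: "(complex \<Rightarrow> complex) set" where
  "bergman_space =
     {g. g holomorphic_on unit_disc \<and> integrable disc_area (\<lambda>z. (cmod (g z))\<^sup>2)}"

text \<open>
  The two norms below are meaningful on the respective spaces; the Bochner integral of a
  non-integrable function is 0.
\<close>

definition bergman_norm :: "(complex \<Rightarrow> complex) \<Rightarrow> real" where
  "bergman_norm g = sqrt (\<integral>z. (cmod (g z))\<^sup>2 \<partial>disc_area)"

definition dirichlet_space :: "(complex \<Rightarrow> complex) set" where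
  "dirichlet_space = {f. f holomorphic_on unit_disc \<and> deriv f \<in> bergman_space}"

definition dirichlet_norm :: "(complex \<Rightarrow> complex) \<Rightarrow> real" where
  "dirichlet_norm f = sqrt ((cmod (f 0))\<^sup>2 + (bergman_norm (deriv f))\<^sup>2)"

definition rotation :: "real \<Rightarrow> (complex \<Rightarrow> complex) \<Rightarrow> complex \<Rightarrow> complex" where
  "rotation t f z = f (exp (\<i> * of_real t) * z)"

definition dilation :: "real \<Rightarrow> (complex \<Rightarrow> complex) \<Rightarrow> complex \<Rightarrow> complex" where
  "dilation r f z = f (of_real r * z)"

text \<open>
  For 0 < r < 1 and holomorphic f the dilation is holomorphic on a neighbourhood of the closed
  disc, hence lies in the Dirichlet space even if f does not.
\<close>

definition dilation_norm :: "real \<Rightarrow> (complex \<Rightarrow> complex) \<Rightarrow> real" where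
  "dilation_norm r f = dirichlet_norm (dilation r f)"

end

theory Submission
  imports Defs
begin

text \<open>
  Everything is read off from the Taylor coefficients \<open>a n\<close> of \<open>f\<close>. Since the monomials are
  orthogonal in the Bergman space, the Dirichlet norm of \<open>f\<close> is the square root of
  \<open>\<bar>a 0\<bar>\<^sup>2 + (\<Sum>n. c n)\<close> with \<open>c n = n * \<bar>a n\<bar>\<^sup>2\<close>. Rotation and dilation multiply \<open>a n\<close> by a
  number depending on \<open>n\<close>, so each of the three quantities is the square root of a weighted sum
  \<open>\<Sum>n. w \<delta> n * c n\<close>, where \<open>\<delta> = \<bar>t\<bar>\<close> for rotations and \<open>\<delta> = 1 - r\<close> for dilations:

    \<^item> \<open>\<bar>exp (\<i> * n * \<delta>) - 1\<bar>\<^sup>2\<close> in (a),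
    \<^item> essentially \<open>\<delta>\<^sup>2 * n\<^sup>2 * (1 - \<delta>) ^ (2 * n)\<close> in (b), once the norm has been multiplied by \<open>\<delta>\<close>,
    \<^item> \<open>((1 - \<delta>) ^ n - 1)\<^sup>2\<close> in (c).

  All three weights have the same two features: they are at most a constant times
  \<open>min 1 ((n * \<delta>)\<^sup>2)\<close>, and they are at least a constant times \<open>(n * \<delta>)\<^sup>2\<close> as long as \<open>n * \<delta> \<le> 1/2\<close>.
  These features alone decide whether the weighted sum is \<open>O(\<delta> powr (2 * \<alpha>))\<close>
  (\<open>saturating_weight_transfer\<close>), so the three conditions are equivalent. The reason is that a
  bound on the truncated sums of \<open>(n * \<eta>)\<^sup>2 * c n\<close> over \<open>n * \<eta> \<le> 1/2\<close>, used at the scales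
  \<open>\<eta> = \<delta>, \<delta>/2, \<delta>/4, \<dots>\<close>, also controls the terms with large \<open>n\<close>: every \<open>n\<close> is captured by one of
  these scales with \<open>n * \<eta>\<close> comparable to \<open>min 1 (n * \<delta>)\<close>, and the bounds
  \<open>(\<delta> / 2 ^ k) powr (2 * \<alpha>)\<close> form a convergent geometric series because \<open>\<alpha> > 0\<close>.

  The orthogonality of the monomials rests on the rotation invariance of the area measure, and
  their norms on the fact that \<open>\<bar>z\<bar>\<^sup>2\<close> is uniformly distributed on \<open>[0, 1]\<close> under the normalized
  area measure.
\<close>

section \<open>Rotation invariance of the Lebesgue measure on the complex plane\<close>

lemma measurable_Complex [measurable]:
  "(\<lambda>(x, y). Complex x y) \<in> borel_measurable (borel \<Otimes>\<^sub>M borel)"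
  unfolding Complex_eq by measurable

lemma lborel_complex_eq_distr:
  "(lborel :: complex measure) = distr (lborel \<Otimes>\<^sub>M lborel) borel (\<lambda>(x, y). Complex x y)"
proof (rule lborel_eqI)
  fix l u :: complex
  assume le: "\<And>b. b \<in> Basis \<Longrightarrow> l \<bullet> b \<le> u \<bullet> b"
  have le': "Re l \<le> Re u" "Im l \<le> Im u"
    using le[of 1] le[of \<i>] by (auto simp: Basis_complex_def)
  have "(\<lambda>(x, y). Complex x y) -` box l u = {Re l<..<Re u} \<times> {Im l<..<Im u}"
    by (auto simp: in_box_complex_iff)
  then have "emeasure (distr (lborel \<Otimes>\<^sub>M lborel) borel (\<lambda>(x, y). Complex x y)) (box l u)
      = emeasure (lborel \<Otimes>\<^sub>M lborel) ({Re l<..<Re u} \<times> {Im l<..<Im u})"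
    by (subst emeasure_distr) (auto simp: space_pair_measure)
  also have "\<dots> = ennreal (Re u - Re l) * ennreal (Im u - Im l)"
    using le' by (subst lborel.emeasure_pair_measure_Times) auto
  also have "\<dots> = ennreal (\<Prod>b\<in>Basis. (u - l) \<bullet> b)"
    using le' by (simp add: Basis_complex_def ennreal_mult'')
  finally show "emeasure (distr (lborel \<Otimes>\<^sub>M lborel) borel (\<lambda>(x, y). Complex x y)) (box l u)
      = ennreal (\<Prod>b\<in>Basis. (u - l) \<bullet> b)" .
qed simp

lemma nn_integral_lborel_complex:
  assumes [measurable]: "f \<in> borel_measurable borel"
  shows "(\<integral>\<^sup>+z. f z \<partial>lborel) = (\<integral>\<^sup>+x. \<integral>\<^sup>+y. f (Complex x y) \<partial>lborel \<partial>lborel)"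
    and "(\<integral>\<^sup>+z. f z \<partial>lborel) = (\<integral>\<^sup>+y. \<integral>\<^sup>+x. f (Complex x y) \<partial>lborel \<partial>lborel)"
proof -
  have [measurable]: "(\<lambda>(x, y). f (Complex x y)) \<in> borel_measurable (lborel \<Otimes>\<^sub>M lborel)"
    unfolding Complex_eq by measurable
  have eq: "(\<integral>\<^sup>+z. f z \<partial>lborel) = (\<integral>\<^sup>+p. (case p of (x, y) \<Rightarrow> f (Complex x y)) \<partial>(lborel \<Otimes>\<^sub>M lborel))"
    by (subst lborel_complex_eq_distr, subst nn_integral_distr) (auto simp: case_prod_unfold)
  show "(\<integral>\<^sup>+z. f z \<partial>lborel) = (\<integral>\<^sup>+x. \<integral>\<^sup>+y. f (Complex x y) \<partial>lborel \<partial>lborel)"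
    unfolding eq by (subst lborel.nn_integral_fst[symmetric]) auto
  show "(\<integral>\<^sup>+z. f z \<partial>lborel) = (\<integral>\<^sup>+y. \<integral>\<^sup>+x. f (Complex x y) \<partial>lborel \<partial>lborel)"
    unfolding eq by (subst lborel_pair.nn_integral_snd[symmetric]) auto
qed

lemma distr_lborel_horizontal_shear:
  fixes a :: real
  shows "distr lborel borel (\<lambda>z. z + of_real (a * Im z)) = (lborel :: complex measure)"
proof (rule measure_eqI)
  fix A :: "complex set" assume "A \<in> sets (distr lborel borel (\<lambda>z. z + of_real (a * Im z)))"
  then have [measurable]: "A \<in> sets borel" by simp
  have "emeasure (distr lborel borel (\<lambda>z. z + of_real (a * Im z))) A =
        (\<integral>\<^sup>+z. indicator A z \<partial>distr lborel borel (\<lambda>z. z + of_real (a * Im z)))"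
    by simp
  also have "\<dots> = (\<integral>\<^sup>+z. indicator A (z + of_real (a * Im z)) \<partial>lborel)"
    by (rule nn_integral_distr) measurable
  also have "\<dots> = (\<integral>\<^sup>+y. \<integral>\<^sup>+x. indicator A (Complex (x + a * y) y) \<partial>lborel \<partial>lborel)"
    by (subst nn_integral_lborel_complex(2)) (auto simp: Complex_eq algebra_simps)
  also have "\<dots> = (\<integral>\<^sup>+y. \<integral>\<^sup>+x. indicator A (Complex x y) \<partial>lborel \<partial>lborel)"
  proof (rule nn_integral_cong)
    fix y :: real
    have [measurable]: "(\<lambda>x. Complex x y) \<in> borel_measurable borel"
      unfolding Complex_eq by measurable
    show "(\<integral>\<^sup>+x. indicator A (Complex (x + a * y) y) \<partial>lborel)
        = (\<integral>\<^sup>+x. indicator A (Complex x y) \<partial>lborel)"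
      by (subst (2) nn_integral_real_affine[where c = 1 and t = "a * y"])
         (auto simp: add.commute)
  qed
  also have "\<dots> = (\<integral>\<^sup>+z. indicator A z \<partial>lborel)"
    by (rule nn_integral_lborel_complex(2)[symmetric]) measurable
  finally show "emeasure (distr lborel borel (\<lambda>z. z + of_real (a * Im z))) A = emeasure lborel A"
    by simp
qed simp

lemma distr_lborel_vertical_shear:
  fixes a :: real
  shows "distr lborel borel (\<lambda>z. z + \<i> * of_real (a * Re z)) = (lborel :: complex measure)"
proof (rule measure_eqI)
  fix A :: "complex set" assume "A \<in> sets (distr lborel borel (\<lambda>z. z + \<i> * of_real (a * Re z)))"
  then have [measurable]: "A \<in> sets borel" by simp
  have "emeasure (distr lborel borel (\<lambda>z. z + \<i> * of_real (a * Re z))) A =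
        (\<integral>\<^sup>+z. indicator A z \<partial>distr lborel borel (\<lambda>z. z + \<i> * of_real (a * Re z)))"
    by simp
  also have "\<dots> = (\<integral>\<^sup>+z. indicator A (z + \<i> * of_real (a * Re z)) \<partial>lborel)"
    by (rule nn_integral_distr) measurable
  also have "\<dots> = (\<integral>\<^sup>+x. \<integral>\<^sup>+y. indicator A (Complex x (y + a * x)) \<partial>lborel \<partial>lborel)"
    by (subst nn_integral_lborel_complex(1)) (auto simp: Complex_eq algebra_simps)
  also have "\<dots> = (\<integral>\<^sup>+x. \<integral>\<^sup>+y. indicator A (Complex x y) \<partial>lborel \<partial>lborel)"
  proof (rule nn_integral_cong)
    fix x :: real
    have [measurable]: "(\<lambda>y. Complex x y) \<in> borel_measurable borel"
      unfolding Complex_eq by measurable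
    show "(\<integral>\<^sup>+y. indicator A (Complex x (y + a * x)) \<partial>lborel)
        = (\<integral>\<^sup>+y. indicator A (Complex x y) \<partial>lborel)"
      by (subst (2) nn_integral_real_affine[where c = 1 and t = "a * x"])
         (auto simp: add.commute)
  qed
  also have "\<dots> = (\<integral>\<^sup>+z. indicator A z \<partial>lborel)"
    by (rule nn_integral_lborel_complex(1)[symmetric]) measurable
  finally show "emeasure (distr lborel borel (\<lambda>z. z + \<i> * of_real (a * Re z))) A = emeasure lborel A"
    by simp
qed simp

text \<open>
  A rotation by an angle \<open>\<theta>\<close> is a product of three shears, a horizontal one by
  \<open>- tan (\<theta>/2)\<close> before and after a vertical one by \<open>sin \<theta>\<close>, and each shear only translates the
  lines that it preserves. Half-turns are left out because \<open>tan (\<theta>/2)\<close> is infinite there.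
\<close>
lemma distr_lborel_rotation:
  fixes w :: complex
  assumes w: "cmod w = 1" "w \<noteq> -1"
  shows "distr lborel borel (\<lambda>z. w * z) = lborel"
proof -
  \<comment> \<open>This is \<open>tan (\<theta>/2)\<close> for \<open>w = cis \<theta>\<close>.\<close>
  define t where "t = Im w / (1 + Re w)"
  define H where "H = (\<lambda>z. z + complex_of_real (- t * Im z))"
  define V where "V = (\<lambda>z. z + \<i> * complex_of_real (Im w * Re z))"
  have [measurable]: "H \<in> borel_measurable borel" "V \<in> borel_measurable borel"
    unfolding H_def V_def by measurable
  have norm: "(Re w)\<^sup>2 + (Im w)\<^sup>2 = 1"
    using w(1) by (simp add: cmod_def)
  have nz: "1 + Re w \<noteq> 0"
  proof
    assume "1 + Re w = 0"
    then have "Re w = -1" by simp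
    with norm have "w = -1" by (simp add: complex_eq_iff)
    with w(2) show False by simp
  qed
  have 1: "Im w * t = 1 - Re w"
  proof -
    have "Im w * Im w = (1 - Re w) * (1 + Re w)"
      using norm by (simp add: power2_eq_square algebra_simps)
    then show ?thesis using nz by (simp add: t_def)
  qed
  have 2: "t * (1 + Re w) = Im w" using nz by (simp add: t_def)
  have eq: "(\<lambda>z. w * z) = H \<circ> (V \<circ> H)"
  proof
    fix z
    have r: "t * Im w = 1 - Re w" "t * Re w = Im w - t" using 1 2 by (simp_all add: algebra_simps)
    have v: "Im (V (H z)) = Im z + Im w * Re z - (Im w * t) * Im z"
      by (simp add: V_def H_def algebra_simps)
    then have v': "Im (V (H z)) = Im w * Re z + Re w * Im z" by (simp only: 1) (simp add: algebra_simps)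
    have u: "Re (V (H z)) = Re z - t * Im z"
      by (simp add: V_def H_def algebra_simps)
    have "Re (H (V (H z))) = Re (V (H z)) - t * Im (V (H z))"
      by (simp add: H_def)
    also have "\<dots> = Re z - t * Im z - (t * Im w) * Re z - (t * Re w) * Im z"
      unfolding u v' by (simp add: algebra_simps)
    also have "\<dots> = Re w * Re z - Im w * Im z"
      unfolding r by (simp add: algebra_simps)
    finally have "Re (H (V (H z))) = Re (w * z)" by simp
    moreover have "Im (H (V (H z))) = Im (w * z)"
      using v' by (simp add: H_def)
    ultimately show "w * z = (H \<circ> (V \<circ> H)) z" by (simp add: complex_eq_iff)
  qed
  have H: "distr lborel borel H = lborel"
    unfolding H_def by (rule distr_lborel_horizontal_shear)
  have V: "distr lborel borel V = lborel"
    unfolding V_def by (rule distr_lborel_vertical_shear)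
  have "distr lborel borel (\<lambda>z. w * z) = distr (distr lborel borel (V \<circ> H)) borel H"
    unfolding eq by (rule distr_distr[symmetric]) measurable
  also have "distr lborel borel (V \<circ> H) = distr (distr lborel borel H) borel V"
    by (rule distr_distr[symmetric]) measurable
  finally show ?thesis by (simp only: H V)
qed

section \<open>The area measure of the disc\<close>

lemma finite_measure_disc_area: "finite_measure disc_area"
  by (rule finite_measureI) (simp add: emeasure_disc_area_unit_disc)

interpretation disc_area: finite_measure disc_area
  by (rule finite_measure_disc_area)

lemma measurable_disc_area: "f \<in> measurable borel M \<Longrightarrow> f \<in> measurable disc_area M"
  by (simp add: disc_area_def measurable_restrict_space1)

lemma continuous_on_measurable_disc_area:
  fixes f :: "complex \<Rightarrow> 'a :: topological_space"
  shows "continuous_on unit_disc f \<Longrightarrow> f \<in> borel_measurable disc_area"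
  using borel_measurable_continuous_on_restrict[of unit_disc f]
    measurable_cong_sets[OF sets_restrict_space_cong[OF sets_lborel] refl]
  by (auto simp: disc_area_def)

lemma integral_disc_area:
  fixes h :: "complex \<Rightarrow> complex"
  assumes [measurable]: "h \<in> borel_measurable borel"
  shows "integral\<^sup>L disc_area h = (1 / pi) *\<^sub>R (\<integral>z. indicator unit_disc z *\<^sub>R h z \<partial>lborel)"
proof -
  have "integral\<^sup>L disc_area h = (\<integral>z. (1 / pi) *\<^sub>R h z \<partial>restrict_space lborel unit_disc)"
    unfolding disc_area_def
    by (rule integral_density) (auto intro: measurable_restrict_space1)
  then show ?thesis using integral_restrict_space[of unit_disc lborel h] by simp
qed

lemma integral_disc_area_rotation:
  fixes h :: "complex \<Rightarrow> complex"
  assumes [measurable]: "h \<in> borel_measurable borel" and w: "cmod w = 1" "w \<noteq> -1"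
  shows "(\<integral>z. h (w * z) \<partial>disc_area) = (\<integral>z. h z \<partial>disc_area)"
proof -
  have [measurable]: "unit_disc \<in> sets borel" by simp
  have "(\<integral>z. indicator unit_disc z *\<^sub>R h z \<partial>lborel)
      = (\<integral>z. indicator unit_disc z *\<^sub>R h z \<partial>distr lborel borel (\<lambda>z. w * z))"
    using distr_lborel_rotation[OF w] by simp
  also have "\<dots> = (\<integral>z. indicator unit_disc (w * z) *\<^sub>R h (w * z) \<partial>lborel)"
    by (rule integral_distr) measurable
  also have "\<dots> = (\<integral>z. indicator unit_disc z *\<^sub>R h (w * z) \<partial>lborel)"
    using w by (simp add: indicator_def norm_mult)
  finally show ?thesis by (simp add: integral_disc_area)
qed

lemma emeasure_disc_area_cball:
  assumes "0 \<le> r" "r < 1"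
  shows "emeasure disc_area (cball 0 r) = ennreal (r\<^sup>2)"
proof -
  have sub: "cball 0 r \<subseteq> unit_disc" using assms by (auto simp: dist_norm)
  have "cball 0 r \<in> sets (restrict_space lborel unit_disc)"
    using sub by (auto simp: sets_restrict_space_iff)
  then show ?thesis
    using assms sub emeasure_cball[of r "0::complex"]
    by (simp add: disc_area_def emeasure_density_const emeasure_restrict_space unit_ball_vol_2
        ennreal_mult[symmetric])
qed

text \<open>
  A disc of radius \<open>r \<le> 1\<close> has normalized area \<open>r\<^sup>2\<close>, so \<open>\<bar>z\<bar>\<^sup>2\<close> is uniformly distributed. This
  replaces polar coordinates for radial integrands.
\<close>
lemma distr_disc_area_norm_square:
  "distr disc_area borel (\<lambda>z. (cmod z)\<^sup>2) = density lborel (indicator {0..1})"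
proof (rule measure_eqI_lessThan)
  have [measurable]: "(\<lambda>z. (cmod z)\<^sup>2) \<in> borel_measurable disc_area"
    by (rule measurable_disc_area) measurable
  fix x :: real
  have sp: "{x<..} \<inter> {0..1} = (if x < 0 then {0..1} else {x<..1})"
    by auto
  have rhs: "emeasure (density lborel (indicator {0..1})) {x<..}
      = (if x < 0 then 1 else ennreal (max 0 (1 - x)))"
    by (auto simp: emeasure_density nn_integral_indicator indicator_inter_arith[symmetric] sp
        Int_commute ennreal_neg max_def mult.commute)
  have vim: "(\<lambda>z. (cmod z)\<^sup>2) -` {x<..} \<inter> space disc_area
       = (if x < 0 then unit_disc else if x < 1 then unit_disc - cball 0 (sqrt x) else {})"
    (is "?L = ?R")
  proof (rule set_eqI)
    fix z :: complex
    have lt1: "(cmod z)\<^sup>2 < 1" if "cmod z < 1"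
      using that by (simp add: power_less_one_iff abs_square_less_1)
    have "x < (cmod z)\<^sup>2 \<longleftrightarrow> sqrt x < cmod z" if "0 \<le> x"
      using that real_less_rsqrt by (metis norm_ge_zero real_sqrt_abs real_sqrt_less_iff abs_norm_cancel)
    then show "z \<in> ?L \<longleftrightarrow> z \<in> ?R"
      using lt1 by (auto simp: not_le less_le_trans[of x 0])
  qed
  have "emeasure disc_area (unit_disc - cball 0 (sqrt x)) = ennreal (1 - x)" if "0 \<le> x" "x < 1"
  proof -
    have sub: "cball 0 (sqrt x) \<subseteq> unit_disc" using that le_less_trans[of _ "sqrt x" 1] by auto
    have "cball 0 (sqrt x) \<in> sets disc_area"
      using sub by (auto simp: disc_area_def sets_restrict_space_iff)
    moreover have "unit_disc \<in> sets disc_area" using sets.top[of disc_area] by simp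
    ultimately show ?thesis
      using that sub
      by (subst emeasure_Diff)
         (auto simp: emeasure_disc_area_cball emeasure_disc_area_unit_disc ennreal_minus
           simp flip: ennreal_1)
  qed
  then show "emeasure (distr disc_area borel (\<lambda>z. (cmod z)\<^sup>2)) {x<..}
      = emeasure (density lborel (indicator {0..1})) {x<..}"
    unfolding rhs by (subst emeasure_distr)
       (auto simp: vim[unfolded space_disc_area] emeasure_disc_area_unit_disc max_def ennreal_neg)
  show "emeasure (distr disc_area borel (\<lambda>z. (cmod z)\<^sup>2)) {x<..} < \<infinity>"
    using disc_area.emeasure_finite by (subst emeasure_distr) (auto simp: top.not_eq_extremum[symmetric])
qed simp_all

lemma integral_disc_area_even_power:
  fixes R :: real
  assumes "0 \<le> R" "R \<le> 1"
  shows "(\<integral>z. indicator (ball 0 R) z * (cmod z) ^ (2 * n) \<partial>disc_area) = R ^ (2 * n + 2) / (n + 1)"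
proof -
  have [measurable]: "(\<lambda>z. (cmod z)\<^sup>2) \<in> borel_measurable disc_area"
    by (rule measurable_disc_area) measurable
  have ind: "indicator (ball 0 R) z = (indicator {0..<R\<^sup>2} ((cmod z)\<^sup>2) :: real)" for z :: complex
    using \<open>0 \<le> R\<close> power_mono_iff[of R "cmod z" 2] by (auto simp: indicator_def not_le[symmetric])
  have "(\<integral>z. indicator (ball 0 R) z * (cmod z) ^ (2 * n) \<partial>disc_area)
      = (\<integral>z. indicator {0..<R\<^sup>2} ((cmod z)\<^sup>2) * ((cmod z)\<^sup>2) ^ n \<partial>disc_area)"
    by (simp add: ind power_mult)
  also have "\<dots> = (\<integral>x. indicator {0..<R\<^sup>2} x * x ^ n \<partial>density lborel (indicator {0..1}))"
    unfolding distr_disc_area_norm_square[symmetric]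
    by (rule integral_distr[symmetric]) measurable
  also have "\<dots> = (\<integral>x. indicator {0..1} x * (indicator {0..<R\<^sup>2} x * x ^ n) \<partial>lborel)"
    using integral_density[of "\<lambda>x. indicator {0..<R\<^sup>2} x * x ^ n" lborel "indicator {0..1} :: real \<Rightarrow> real"]
    by (simp add: ennreal_indicator)
  also have "\<dots> = (\<integral>x. indicator {0..R\<^sup>2} x *\<^sub>R x ^ n \<partial>lborel)"
  proof (rule integral_cong_AE)
    have "R\<^sup>2 \<le> 1" using assms by (simp add: power_le_one)
    then show "AE x in lborel. indicator {0..1} x * (indicator {0..<R\<^sup>2} x * x ^ n) 
          = indicator {0..R\<^sup>2} x *\<^sub>R x ^ n"
      using AE_lborel_singleton[of "R\<^sup>2"] by (auto simp: indicator_def elim!: eventually_mono)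
  qed measurable
  also have "\<dots> = (\<integral>x. x ^ n * indicator {0..R\<^sup>2} x \<partial>lborel)"
    by (simp add: mult.commute)
  also have "\<dots> = ((R\<^sup>2) ^ Suc n - 0 ^ Suc n) / Suc n"
    by (rule integral_power) simp
  finally have "(\<integral>z. indicator (ball 0 R) z * (cmod z) ^ (2 * n) \<partial>disc_area) = (R\<^sup>2) ^ Suc n / Suc n"
    by simp
  moreover have "(R\<^sup>2) ^ Suc n = R ^ (2 * n + 2)"
    by (metis power_mult mult_Suc_right add.commute)
  ultimately show ?thesis by (simp add: add.commute)
qed

section \<open>Norms in terms of Taylor coefficients\<close>

text \<open>
  For \<open>m \<noteq> n\<close>, a rotation by \<open>w\<close> multiplies the integrand by \<open>w ^ m * cnj w ^ n\<close> but preserves the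
  integral, which must vanish if this factor is not 1.
\<close>
lemma integral_disc_area_monomials:
  fixes R :: real
  assumes "0 \<le> R" "R \<le> 1"
  shows "(\<integral>z. indicator (ball 0 R) z *\<^sub>R (z ^ m * cnj z ^ n) \<partial>disc_area)
       = (if m = n then of_real (R ^ (2 * n + 2) / (n + 1)) else 0)"
proof (cases "m = n")
  case True
  have "indicator (ball 0 R) z *\<^sub>R (z ^ n * cnj z ^ n)
      = of_real (indicator (ball 0 R) z * (cmod z) ^ (2 * n))" for z
    by (simp add: scaleR_conv_of_real power_mult power_mult_distrib[symmetric]
        complex_norm_square[symmetric])
  then have "(\<integral>z. indicator (ball 0 R) z *\<^sub>R (z ^ n * cnj z ^ n) \<partial>disc_area)
      = of_real (\<integral>z. indicator (ball 0 R) z * (cmod z) ^ (2 * n) \<partial>disc_area)"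
    by (simp only: integral_complex_of_real)
  then show ?thesis
    unfolding integral_disc_area_even_power[OF assms] using True by simp
next
  case False
  define h where "h = (\<lambda>z. indicator (ball 0 R) z *\<^sub>R (z ^ m * cnj z ^ n) :: complex)"
  \<comment> \<open>The angle is chosen to make the factor \<open>cis ((m - n) * \<theta>)\<close> equal to \<open>\<i>\<close>. Since \<open>\<i>\<close> is not
    real, \<open>w\<close> is then certainly not the excluded rotation \<open>-1\<close>.\<close>
  define w where "w = cis (pi / (2 * (real m - real n)))"
  have w: "cmod w = 1" by (simp add: w_def)
  have "w ^ m * cnj w ^ n = cis (real m * (pi / (2 * (real m - real n)))
      + real n * (- (pi / (2 * (real m - real n)))))"
    by (simp add: w_def cis_cnj Complex.DeMoivre cis_mult)
  also have "real m * (pi / (2 * (real m - real n)))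
      + real n * (- (pi / (2 * (real m - real n)))) = pi / 2"
    using False by (simp add: divide_simps) (simp add: algebra_simps)
  finally have wi: "w ^ m * cnj w ^ n = \<i>" by simp
  have "w \<noteq> -1"
  proof
    assume "w = -1"
    with wi have "(-1) ^ (m + n) = \<i>" by (simp add: power_add)
    then show False by (cases "even (m + n)") (auto simp: complex_eq_iff)
  qed
  moreover have [measurable]: "h \<in> borel_measurable borel"
    unfolding h_def by (intro borel_measurable_scaleR borel_measurable_indicator) 
      (auto intro!: borel_measurable_continuous_onI continuous_intros)
  ultimately have "(\<integral>z. h z \<partial>disc_area) = (\<integral>z. h (w * z) \<partial>disc_area)"
    using w by (simp add: integral_disc_area_rotation)
  also have "\<dots> = (\<integral>z. \<i> * h z \<partial>disc_area)"
  proof (rule Bochner_Integration.integral_cong)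
    fix z
    have "indicator (ball 0 R) (w * z) = (indicator (ball 0 R) z :: real)"
      using w by (simp add: indicator_def norm_mult)
    then have "h (w * z) = (w ^ m * cnj w ^ n) * h z"
      by (simp add: h_def power_mult_distrib mult_ac)
    then show "h (w * z) = \<i> * h z" by (simp add: wi)
  qed simp
  also have "\<dots> = \<i> * (\<integral>z. h z \<partial>disc_area)" by simp
  finally have "(1 - \<i>) * (\<integral>z. h z \<partial>disc_area) = 0"
    by (simp add: left_diff_distrib)
  moreover have "1 - \<i> \<noteq> 0" by (simp add: complex_eq_iff)
  ultimately have "(\<integral>z. h z \<partial>disc_area) = 0" by simp
  then show ?thesis using False by (simp add: h_def)
qed

lemma integral_disc_area_polynomial:
  fixes b :: "nat \<Rightarrow> complex" and R :: real
  assumes R: "0 \<le> R" "R \<le> 1"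
  shows "(\<integral>z. indicator (ball 0 R) z * (cmod (\<Sum>n<N. b n * z ^ n))\<^sup>2 \<partial>disc_area)
       = (\<Sum>n<N. (cmod (b n))\<^sup>2 * R ^ (2 * n + 2) / (n + 1))"
proof -
  define e where "e = (\<lambda>m n z. indicator (ball 0 R) z *\<^sub>R (z ^ m * cnj z ^ n) :: complex)"
  have int: "integrable disc_area (e m n)" for m n
  proof (rule disc_area.integrable_const_bound[where B = 1])
    have "cmod (e m n z) \<le> 1" if "cmod z < 1" for z
      using that by (auto simp: e_def indicator_def norm_mult norm_power power_le_one mult_le_one)
    then show "AE z in disc_area. cmod (e m n z) \<le> 1" by (intro AE_I2) simp
    show "e m n \<in> borel_measurable disc_area"
      unfolding e_def by (intro measurable_disc_area borel_measurable_scaleR borel_measurable_indicator)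
      (auto intro!: borel_measurable_continuous_onI continuous_intros)
  qed
  have "complex_of_real (indicator (ball 0 R) z * (cmod (\<Sum>n<N. b n * z ^ n))\<^sup>2)
      = (\<Sum>m<N. \<Sum>n<N. b m * cnj (b n) * e m n z)" for z
    unfolding of_real_mult complex_norm_square e_def
    unfolding cnj_sum sum_product unfolding sum_distrib_left
    by (intro sum.cong refl) (simp add: scaleR_conv_of_real mult_ac)
  then have "complex_of_real (\<integral>z. indicator (ball 0 R) z * (cmod (\<Sum>n<N. b n * z ^ n))\<^sup>2 \<partial>disc_area)
      = (\<integral>z. (\<Sum>m<N. \<Sum>n<N. b m * cnj (b n) * e m n z) \<partial>disc_area)"
    by (simp flip: integral_complex_of_real)
  also have "\<dots> = (\<Sum>m<N. \<Sum>n<N. b m * cnj (b n) * (\<integral>z. e m n z \<partial>disc_area))"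
    by (simp add: int)
  also have "\<dots> = (\<Sum>m<N. \<Sum>n<N. b m * cnj (b n) * (if m = n then of_real (R ^ (2 * n + 2) / (n + 1)) else 0))"
    unfolding e_def using R by (simp only: integral_disc_area_monomials)
  also have "\<dots> = (\<Sum>m<N. b m * cnj (b m) * of_real (R ^ (2 * m + 2) / (m + 1)))"
    by (intro sum.cong refl) (simp add: if_distrib[of "(*) _"] cong: if_cong)
  also have "\<dots> = complex_of_real (\<Sum>n<N. (cmod (b n))\<^sup>2 * R ^ (2 * n + 2) / (n + 1))"
    by (simp add: complex_norm_square[symmetric] del: power_Suc)
  finally show ?thesis by (simp only: of_real_eq_iff)
qed

text \<open>
  This makes the partial sums uniformly bounded on smaller discs, as dominated convergence
  requires.
\<close>
lemma abs_summable_in_unit_disc: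
  fixes b :: "nat \<Rightarrow> complex"
  assumes "\<And>z. z \<in> unit_disc \<Longrightarrow> (\<lambda>n. b n * z ^ n) sums g z" and R: "0 \<le> R" "R < 1"
  shows "summable (\<lambda>n. cmod (b n) * R ^ n)"
proof -
  define x where "x = complex_of_real ((R + 1) / 2)"
  have "cmod x < 1" "R < cmod x" using R by (simp_all add: x_def norm_divide flip: of_real_add)
  then have "summable (\<lambda>n. b n * x ^ n)" using assms(1)[of x] by (auto simp: sums_iff)
  then have "summable (\<lambda>n. norm (b n * of_real R ^ n))"
    by (rule powser_insidea) (use R \<open>R < cmod x\<close> in simp)
  then show ?thesis using R by (simp add: norm_mult norm_power)
qed

lemma has_field_derivative_power_series_unit_disc:
  fixes b :: "nat \<Rightarrow> complex"
  assumes g: "\<And>z. z \<in> unit_disc \<Longrightarrow> (\<lambda>n. b n * z ^ n) sums g z" and z: "z \<in> unit_disc"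
  shows "(g has_field_derivative (\<Sum>n. diffs b n * z ^ n)) (at z)"
proof (rule has_field_derivative_transform_within_open[where S = unit_disc])
  show "((\<lambda>z. \<Sum>n. b n * z ^ n) has_field_derivative (\<Sum>n. diffs b n * z ^ n)) (at z)"
    by (rule termdiffs_strong'[where K = 1]) (use g z in \<open>auto simp: sums_iff\<close>)
qed (use g z in \<open>auto simp: sums_iff\<close>)

text \<open>
  On a disc of radius \<open>R < 1\<close> the partial sums are uniformly bounded, so the identity for
  polynomials passes to the limit by dominated convergence.
\<close>
lemma integral_subdisc_power_series:
  fixes b :: "nat \<Rightarrow> complex"
  assumes g: "\<And>z. z \<in> unit_disc \<Longrightarrow> (\<lambda>n. b n * z ^ n) sums g z" and R: "0 \<le> R" "R < 1"
  shows "integrable disc_area (\<lambda>z. indicator (ball 0 R) z * (cmod (g z))\<^sup>2)"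
    and "(\<lambda>n. (cmod (b n))\<^sup>2 * R ^ (2 * n + 2) / (n + 1)) sums
          (\<integral>z. indicator (ball 0 R) z * (cmod (g z))\<^sup>2 \<partial>disc_area)"
proof -
  define s where "s = (\<lambda>N z. indicator (ball 0 R) z * (cmod (\<Sum>n<N. b n * z ^ n))\<^sup>2 :: real)"
  define B where "B = (\<Sum>n. cmod (b n) * R ^ n)"
  have sm: "summable (\<lambda>n. cmod (b n) * R ^ n)"
    using abs_summable_in_unit_disc[OF g R] .
  have B0: "0 \<le> B" unfolding B_def using sm R by (intro suminf_nonneg) auto
  have bound: "norm (s N z) \<le> B\<^sup>2" for N z
  proof (cases "cmod z < R")
    case True
    have "cmod (\<Sum>n<N. b n * z ^ n) \<le> (\<Sum>n<N. cmod (b n) * R ^ n)"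
      using True R by (intro sum_norm_le) (auto simp: norm_mult norm_power intro!: mult_left_mono power_mono)
    also have "\<dots> \<le> B" unfolding B_def using sm R by (intro sum_le_suminf) auto
    finally show ?thesis using True by (auto simp: s_def intro!: power_mono)
  qed (simp add: s_def)
  have meas_ind: "(indicator (ball 0 R) :: complex \<Rightarrow> real) \<in> borel_measurable disc_area"
    by (intro measurable_disc_area borel_measurable_indicator) simp
  have meas_s: "s N \<in> borel_measurable disc_area" for N
    unfolding s_def by (intro borel_measurable_times meas_ind measurable_disc_area
       borel_measurable_continuous_onI continuous_intros)
  have cont: "continuous_on unit_disc g"
    using has_field_derivative_power_series_unit_disc[OF g]
    by (meson DERIV_isCont continuous_at_imp_continuous_on)
  have meas_g: "(\<lambda>z. indicator (ball 0 R) z * (cmod (g z))\<^sup>2) \<in> borel_measurable disc_area"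
    by (intro borel_measurable_times meas_ind continuous_on_measurable_disc_area continuous_intros cont)
  have lim: "AE z in disc_area. (\<lambda>N. s N z) \<longlonglongrightarrow> indicator (ball 0 R) z * (cmod (g z))\<^sup>2"
  proof (rule AE_I2)
    fix z assume "z \<in> space disc_area"
    then have "(\<lambda>N. \<Sum>n<N. b n * z ^ n) \<longlonglongrightarrow> g z" using g by (simp add: sums_def)
    then show "(\<lambda>N. s N z) \<longlonglongrightarrow> indicator (ball 0 R) z * (cmod (g z))\<^sup>2"
      unfolding s_def by (intro tendsto_intros)
  qed
  show "integrable disc_area (\<lambda>z. indicator (ball 0 R) z * (cmod (g z))\<^sup>2)"
    by (rule integrable_dominated_convergence[OF meas_g meas_s _ lim, of "\<lambda>_. B\<^sup>2"])
       (use bound in auto)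
  have "(\<lambda>N. \<integral>z. s N z \<partial>disc_area) \<longlonglongrightarrow> (\<integral>z. indicator (ball 0 R) z * (cmod (g z))\<^sup>2 \<partial>disc_area)"
    by (rule integral_dominated_convergence[OF meas_g meas_s _ lim, of "\<lambda>_. B\<^sup>2"])
       (use bound in auto)
  then show "(\<lambda>n. (cmod (b n))\<^sup>2 * R ^ (2 * n + 2) / (n + 1)) sums
          (\<integral>z. indicator (ball 0 R) z * (cmod (g z))\<^sup>2 \<partial>disc_area)"
    using R by (simp add: s_def integral_disc_area_polynomial sums_def)
qed

text \<open>
  Both sides are monotone limits of their counterparts on discs of radius \<open>R < 1\<close>. Working with
  extended nonnegative numbers, the identity also shows that a function in the Bergman space has a
  summable coefficient sequence.
\<close>
lemma nn_integral_disc_area_power_series: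
  fixes b :: "nat \<Rightarrow> complex"
  assumes g: "\<And>z. z \<in> unit_disc \<Longrightarrow> (\<lambda>n. b n * z ^ n) sums g z"
  shows "(\<integral>\<^sup>+z. ennreal ((cmod (g z))\<^sup>2) \<partial>disc_area) = (\<Sum>n. ennreal ((cmod (b n))\<^sup>2 / (n + 1)))"
proof -
  define R where "R = (\<lambda>k::nat. 1 - 1 / (real k + 1))"
  have R: "0 \<le> R k" "R k < 1" for k by (auto simp: R_def)
  have incR: "incseq R"
    by (auto simp: R_def incseq_def intro!: divide_left_mono)
  have limR: "R \<longlonglongrightarrow> 1"
    unfolding R_def by real_asymp
  have meas: "(\<lambda>z. ennreal (indicator (ball 0 (R k)) z * (cmod (g z))\<^sup>2)) \<in> borel_measurable disc_area" for k
    using integral_subdisc_power_series(1)[OF g R] by (intro measurable_compose[OF _ measurable_ennreal]) auto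
  have inc: "incseq (\<lambda>k. ennreal ((cmod (b n))\<^sup>2 * R k ^ (2 * n + 2) / (n + 1)))" for n
  proof (rule incseq_SucI, rule ennreal_leI)
    fix k
    have "R k ^ (2 * n + 2) \<le> R (Suc k) ^ (2 * n + 2)"
      using incR R by (intro power_mono incseq_SucD)
    then show "(cmod (b n))\<^sup>2 * R k ^ (2 * n + 2) / (n + 1)
        \<le> (cmod (b n))\<^sup>2 * R (Suc k) ^ (2 * n + 2) / (n + 1)"
      by (intro divide_right_mono mult_left_mono) simp_all
  qed
  have "(\<integral>\<^sup>+z. ennreal ((cmod (g z))\<^sup>2) \<partial>disc_area)
      = (\<integral>\<^sup>+z. (SUP k. ennreal (indicator (ball 0 (R k)) z * (cmod (g z))\<^sup>2)) \<partial>disc_area)"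
  proof (rule nn_integral_cong)
    fix z assume "z \<in> space disc_area"
    then have "eventually (\<lambda>k. cmod z < R k) sequentially"
      using order_tendstoD(1)[OF limR] by simp
    then obtain k where k: "cmod z < R k" by (auto simp: eventually_sequentially)
    show "ennreal ((cmod (g z))\<^sup>2) = (SUP k. ennreal (indicator (ball 0 (R k)) z * (cmod (g z))\<^sup>2))"
    proof (rule antisym)
      show "ennreal ((cmod (g z))\<^sup>2) \<le> (SUP k. ennreal (indicator (ball 0 (R k)) z * (cmod (g z))\<^sup>2))"
        by (rule SUP_upper2[of k]) (use k in auto)
      show "(SUP k. ennreal (indicator (ball 0 (R k)) z * (cmod (g z))\<^sup>2)) \<le> ennreal ((cmod (g z))\<^sup>2)"
        by (rule SUP_least) (auto simp: indicator_def intro!: ennreal_leI)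
    qed
  qed
  also have "\<dots> = (SUP k. \<integral>\<^sup>+z. ennreal (indicator (ball 0 (R k)) z * (cmod (g z))\<^sup>2) \<partial>disc_area)"
  proof (rule nn_integral_monotone_convergence_SUP[OF _ meas])
    have "R i \<le> R j" if "i \<le> j" for i j using incR that by (simp add: incseq_def)
    then show "incseq (\<lambda>k z. ennreal (indicator (ball 0 (R k)) z * (cmod (g z))\<^sup>2))"
      by (fastforce simp: incseq_def le_fun_def indicator_def intro!: ennreal_leI)
  qed
  also have "\<dots> = (SUP k. \<Sum>n. ennreal ((cmod (b n))\<^sup>2 * R k ^ (2 * n + 2) / (n + 1)))"
  proof (rule SUP_cong[OF refl])
    fix k
    have P: "integrable disc_area (\<lambda>z. indicator (ball 0 (R k)) z * (cmod (g z))\<^sup>2)"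
      "(\<lambda>n. (cmod (b n))\<^sup>2 * R k ^ (2 * n + 2) / (n + 1)) sums
        (\<integral>z. indicator (ball 0 (R k)) z * (cmod (g z))\<^sup>2 \<partial>disc_area)"
      by (rule integral_subdisc_power_series[OF g R], assumption)+
    have "(\<integral>\<^sup>+z. ennreal (indicator (ball 0 (R k)) z * (cmod (g z))\<^sup>2) \<partial>disc_area)
       = ennreal (\<integral>z. indicator (ball 0 (R k)) z * (cmod (g z))\<^sup>2 \<partial>disc_area)"
      by (rule nn_integral_eq_integral[OF P(1)]) (intro AE_I2, simp)
    also have "\<dots> = ennreal (\<Sum>n. (cmod (b n))\<^sup>2 * R k ^ (2 * n + 2) / (n + 1))"
      using P(2) by (simp add: sums_iff)
    also have "\<dots> = (\<Sum>n. ennreal ((cmod (b n))\<^sup>2 * R k ^ (2 * n + 2) / (n + 1)))"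
      using sums_summable[OF P(2)] R[of k] by (intro suminf_ennreal2[symmetric]) auto
    finally show "(\<integral>\<^sup>+z. ennreal (indicator (ball 0 (R k)) z * (cmod (g z))\<^sup>2) \<partial>disc_area)
       = (\<Sum>n. ennreal ((cmod (b n))\<^sup>2 * R k ^ (2 * n + 2) / (n + 1)))" .
  qed
  also have "\<dots> = (\<Sum>n. SUP k. ennreal ((cmod (b n))\<^sup>2 * R k ^ (2 * n + 2) / (n + 1)))"
    using inc by (rule ennreal_suminf_SUP_eq[symmetric])
  also have "\<dots> = (\<Sum>n. ennreal ((cmod (b n))\<^sup>2 / (n + 1)))"
  proof (rule suminf_cong)
    fix n
    have "(\<lambda>k. ennreal ((cmod (b n))\<^sup>2 * R k ^ (2 * n + 2) / (n + 1)))
        \<longlonglongrightarrow> ennreal ((cmod (b n))\<^sup>2 * 1 ^ (2 * n + 2) / (n + 1))"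
      by (intro tendsto_ennrealI tendsto_intros limR) simp
    from LIMSEQ_unique[OF LIMSEQ_SUP[OF inc] this]
    show "(SUP k. ennreal ((cmod (b n))\<^sup>2 * R k ^ (2 * n + 2) / (n + 1)))
        = ennreal ((cmod (b n))\<^sup>2 / (n + 1))" by simp
  qed
  finally show ?thesis .
qed

lemma bergman_norm_power_series:
  fixes b :: "nat \<Rightarrow> complex"
  assumes g: "\<And>z. z \<in> unit_disc \<Longrightarrow> (\<lambda>n. b n * z ^ n) sums g z"
    and sm: "summable (\<lambda>n. (cmod (b n))\<^sup>2 / (n + 1))"
  shows "(bergman_norm g)\<^sup>2 = (\<Sum>n. (cmod (b n))\<^sup>2 / (n + 1))"
proof -
  have cont: "continuous_on unit_disc g"
    using has_field_derivative_power_series_unit_disc[OF g]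
    by (meson DERIV_isCont continuous_at_imp_continuous_on)
  have "(\<integral>z. (cmod (g z))\<^sup>2 \<partial>disc_area) = enn2real (\<integral>\<^sup>+z. ennreal ((cmod (g z))\<^sup>2) \<partial>disc_area)"
    by (rule integral_eq_nn_integral)
       (auto intro!: continuous_on_measurable_disc_area continuous_intros cont)
  also have "(\<integral>\<^sup>+z. ennreal ((cmod (g z))\<^sup>2) \<partial>disc_area) = (\<Sum>n. ennreal ((cmod (b n))\<^sup>2 / (n + 1)))"
    by (rule nn_integral_disc_area_power_series[OF g])
  also have "\<dots> = ennreal (\<Sum>n. (cmod (b n))\<^sup>2 / (n + 1))"
    by (rule suminf_ennreal2[OF _ sm]) simp
  also have "enn2real \<dots> = (\<Sum>n. (cmod (b n))\<^sup>2 / (n + 1))"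
    by (intro enn2real_ennreal suminf_nonneg sm) simp
  finally have *: "(\<integral>z. (cmod (g z))\<^sup>2 \<partial>disc_area) = (\<Sum>n. (cmod (b n))\<^sup>2 / (n + 1))" .
  show ?thesis unfolding bergman_norm_def * by (intro real_sqrt_pow2 suminf_nonneg sm) auto
qed

lemma deriv_sums_unit_disc:
  fixes a :: "nat \<Rightarrow> complex"
  assumes f: "\<And>z. z \<in> unit_disc \<Longrightarrow> (\<lambda>n. a n * z ^ n) sums f z" and z: "z \<in> unit_disc"
  shows "(\<lambda>n. diffs a n * z ^ n) sums deriv f z"
proof -
  have "deriv f z = (\<Sum>n. diffs a n * z ^ n)"
    using has_field_derivative_power_series_unit_disc[OF f z] by (rule DERIV_imp_deriv)
  moreover have "summable (\<lambda>n. diffs a n * z ^ n)"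
  proof (rule termdiff_converges[where K = 1])
    show "summable (\<lambda>n. a n * x ^ n)" if "norm x < 1" for x
      using f[of x] that by (simp add: sums_iff)
  qed (use z in simp)
  ultimately show ?thesis by (simp add: sums_iff)
qed

lemma norm_diffs_square:
  fixes a :: "nat \<Rightarrow> complex" and n :: nat
  shows "(cmod (diffs a n))\<^sup>2 / (n + 1) = Suc n * (cmod (a (Suc n)))\<^sup>2"
proof -
  have "(cmod (diffs a n))\<^sup>2 = (Suc n)\<^sup>2 * (cmod (a (Suc n)))\<^sup>2"
    by (simp only: diffs_def norm_mult power_mult_distrib norm_of_nat of_nat_power)
  also have "\<dots> = real (Suc n) * (real (Suc n) * (cmod (a (Suc n)))\<^sup>2)"
    by (simp only: of_nat_power of_nat_mult power2_eq_square mult_ac)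
  finally show ?thesis
    by (simp only: Suc_eq_plus1[symmetric] nonzero_mult_div_cancel_left of_nat_neq_0 simp_thms)
qed

lemma dirichlet_norm_power_series:
  fixes a :: "nat \<Rightarrow> complex"
  assumes f: "\<And>z. z \<in> unit_disc \<Longrightarrow> (\<lambda>n. a n * z ^ n) sums f z"
    and sm: "summable (\<lambda>n. n * (cmod (a n))\<^sup>2)"
  shows "dirichlet_norm f = sqrt ((cmod (a 0))\<^sup>2 + (\<Sum>n. n * (cmod (a n))\<^sup>2))"
proof -
  have f0: "f 0 = a 0"
    using f[of 0] by simp
  have d: "(\<lambda>n. diffs a n * z ^ n) sums deriv f z" if "z \<in> unit_disc" for z
    using deriv_sums_unit_disc[OF f that] .
  have sm': "summable (\<lambda>n. Suc n * (cmod (a (Suc n)))\<^sup>2)"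
    using iffD2[OF summable_Suc_iff[of "\<lambda>n. n * (cmod (a n))\<^sup>2"] sm] .
  have "(bergman_norm (deriv f))\<^sup>2 = (\<Sum>n. Suc n * (cmod (a (Suc n)))\<^sup>2)"
  proof -
    have "summable (\<lambda>n. (cmod (diffs a n))\<^sup>2 / (n + 1))"
      using sm' by (simp only: norm_diffs_square)
    from bergman_norm_power_series[of "diffs a" "deriv f", OF d this]
    show ?thesis by (simp only: norm_diffs_square)
  qed
  also have "\<dots> = (\<Sum>n. n * (cmod (a n))\<^sup>2)"
    using suminf_split_head[OF sm] by (simp del: of_nat_Suc)
  finally show ?thesis by (simp add: dirichlet_norm_def f0)
qed

lemma dirichlet_space_power_series:
  assumes "f \<in> dirichlet_space"
  obtains a :: "nat \<Rightarrow> complex" where "\<And>z. z \<in> unit_disc \<Longrightarrow> (\<lambda>n. a n * z ^ n) sums f z"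
    and "\<And>z. z \<in> unit_disc \<Longrightarrow> (\<lambda>n. diffs a n * z ^ n) sums deriv f z"
    and "summable (\<lambda>n. n * (cmod (a n))\<^sup>2)"
proof -
  have hol: "f holomorphic_on unit_disc" and int: "integrable disc_area (\<lambda>z. (cmod (deriv f z))\<^sup>2)"
    using assms by (auto simp: dirichlet_space_def bergman_space_def)
  define a where "a = (\<lambda>n. (deriv ^^ n) f 0 / fact n)"
  have f: "(\<lambda>n. a n * z ^ n) sums f z" if "z \<in> unit_disc" for z
    using holomorphic_power_series[OF hol that] by (simp add: a_def)
  have d: "(\<lambda>n. diffs a n * z ^ n) sums deriv f z" if "z \<in> unit_disc" for z
    using deriv_sums_unit_disc[OF f that] .
  have "(\<integral>\<^sup>+z. ennreal ((cmod (deriv f z))\<^sup>2) \<partial>disc_area) < \<infinity>"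
    using int unfolding integrable_iff_bounded by simp
  moreover have "(\<integral>\<^sup>+z. ennreal ((cmod (deriv f z))\<^sup>2) \<partial>disc_area)
      = (\<Sum>n. ennreal ((cmod (diffs a n))\<^sup>2 / (n + 1)))"
    by (rule nn_integral_disc_area_power_series[OF d])
  ultimately have "(\<Sum>n. ennreal ((cmod (diffs a n))\<^sup>2 / (n + 1))) \<noteq> top"
    by simp
  then have "summable (\<lambda>n. (cmod (diffs a n))\<^sup>2 / (n + 1))"
    by (intro summable_suminf_not_top) auto
  then have "summable (\<lambda>n. Suc n * (cmod (a (Suc n)))\<^sup>2)"
    by (simp only: norm_diffs_square)
  then have "summable (\<lambda>n. n * (cmod (a n))\<^sup>2)"
    using iffD1[OF summable_Suc_iff[of "\<lambda>n. n * (cmod (a n))\<^sup>2"]] by blast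
  with f d show thesis by (rule that)
qed

section \<open>Sums with saturating weights\<close>

text \<open>
  The class of weights that grow like \<open>(n * \<delta>)\<^sup>2\<close> up to \<open>n \<approx> 1 / \<delta>\<close> and stay bounded afterwards.
  For large \<open>n\<close> no lower bound is imposed, because \<open>\<bar>exp (\<i> * n * \<delta>) - 1\<bar>\<^sup>2\<close> comes
  arbitrarily close to 0 and \<open>(n * \<delta>)\<^sup>2 * (1 - \<delta>) ^ (2 * n)\<close> tends to 0.
\<close>
definition saturating_weight :: "(real \<Rightarrow> nat \<Rightarrow> real) \<Rightarrow> bool" where
  "saturating_weight w \<longleftrightarrow> (\<exists>lo>0. \<exists>hi>0. \<forall>\<delta>\<in>{0<..<1}. \<forall>n.
     0 \<le> w \<delta> n \<and> w \<delta> n \<le> hi * min 1 ((n * \<delta>)\<^sup>2) \<and> (n * \<delta> \<le> 1 / 2 \<longrightarrow> lo * (n * \<delta>)\<^sup>2 \<le> w \<delta> n))"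

lemma saturating_weightI:
  assumes "0 < lo" "0 < hi"
    and "\<And>\<delta> n. 0 < \<delta> \<Longrightarrow> \<delta> < 1 \<Longrightarrow> 0 \<le> w \<delta> n"
    and "\<And>\<delta> n. 0 < \<delta> \<Longrightarrow> \<delta> < 1 \<Longrightarrow> w \<delta> n \<le> hi"
    and "\<And>\<delta> n. 0 < \<delta> \<Longrightarrow> \<delta> < 1 \<Longrightarrow> w \<delta> n \<le> hi * (n * \<delta>)\<^sup>2"
    and "\<And>\<delta> n. 0 < \<delta> \<Longrightarrow> \<delta> < 1 \<Longrightarrow> n * \<delta> \<le> 1 / 2 \<Longrightarrow> lo * (n * \<delta>)\<^sup>2 \<le> w \<delta> n"
  shows "saturating_weight w"
  unfolding saturating_weight_def
  by (rule exI[of _ lo], rule conjI[OF assms(1)], rule exI[of _ hi], rule conjI[OF assms(2)])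
     (use assms(3-) in \<open>auto simp: min_def\<close>)

text \<open>
  Let \<open>k\<close> be the first scale with \<open>n * \<delta> / 2 ^ k \<le> 1/2\<close>. Either \<open>k = 0\<close> and the term of index 0
  suffices, or minimality of \<open>k\<close> gives \<open>n * \<delta> / 2 ^ k > 1/4\<close>, so that the factor 16 makes the term
  of index \<open>k\<close> at least 1. As \<open>k \<le> n\<close>, it is enough to sum up to any bound \<open>M\<close> for \<open>n\<close>.
\<close>
lemma min_one_square_le_dyadic_sum:
  fixes \<delta> :: real and n M :: nat
  assumes \<delta>: "0 < \<delta>" "\<delta> \<le> 1" and "n \<le> M"
  shows "min 1 ((n * \<delta>)\<^sup>2)
       \<le> (\<Sum>k\<le>M. if n * (\<delta> / 2 ^ k) \<le> 1 / 2 then 16 * (n * (\<delta> / 2 ^ k))\<^sup>2 else 0)"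
    (is "_ \<le> (\<Sum>k\<le>M. ?t k)")
proof -
  have half: "real n / 2 ^ n \<le> 1 / 2"
  proof -
    have "2 * n \<le> 2 ^ n"
    proof (induction n)
      case (Suc n)
      then show ?case by (cases n) auto
    qed simp
    then have "2 * real n \<le> 2 ^ n"
      by (metis of_nat_le_iff of_nat_mult of_nat_numeral of_nat_power)
    then show ?thesis by (simp add: field_simps)
  qed
  have ex: "n * (\<delta> / 2 ^ n) \<le> 1 / 2"
  proof -
    have "n * (\<delta> / 2 ^ n) = \<delta> * (n / 2 ^ n)" by simp
    also have "\<dots> \<le> 1 * (n / 2 ^ n)" using \<delta> by (intro mult_right_mono) auto
    also have "\<dots> \<le> 1 / 2" using half by simp
    finally show ?thesis .
  qed
  define k where "k = (LEAST k. n * (\<delta> / 2 ^ k) \<le> 1 / 2)"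
  have k: "n * (\<delta> / 2 ^ k) \<le> 1 / 2" "k \<le> n"
    unfolding k_def using ex by (rule LeastI) (use ex in \<open>rule Least_le\<close>)
  have "min 1 ((n * \<delta>)\<^sup>2) \<le> ?t k"
  proof (cases k)
    case 0
    then have "n * \<delta> \<le> 1 / 2" using k by simp
    moreover have "min 1 ((n * \<delta>)\<^sup>2) \<le> 16 * (n * \<delta>)\<^sup>2"
      by (rule order_trans[OF min.cobounded2]) simp
    ultimately show ?thesis using 0 by simp
  next
    case (Suc j)
    define y where "y = n * (\<delta> / 2 ^ j)"
    have "\<not> y \<le> 1 / 2"
      using not_less_Least[of j "\<lambda>k. n * (\<delta> / 2 ^ k) \<le> 1 / 2"] Suc k_def y_def by simp
    moreover have y: "n * (\<delta> / 2 ^ k) = y / 2" by (simp add: Suc y_def)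
    ultimately have "1 / 4 \<le> n * (\<delta> / 2 ^ k)" unfolding y by simp
    then have "(1 / 4)\<^sup>2 \<le> (n * (\<delta> / 2 ^ k))\<^sup>2" by (rule power_mono) simp
    then have "1 \<le> 16 * (n * (\<delta> / 2 ^ k))\<^sup>2" by (simp add: power2_eq_square)
    then show ?thesis using k by (simp add: min_def)
  qed
  also have "\<dots> \<le> (\<Sum>k\<le>M. ?t k)"
    by (rule member_le_sum) (use k \<open>n \<le> M\<close> in auto)
  finally show ?thesis .
qed

text \<open>
  The truncated sums see only \<open>n \<le> 1 / (2 * \<eta>)\<close>. Adding them up over the scales
  \<open>\<eta> = \<delta> / 2 ^ k\<close> recovers all \<open>n\<close>, at the cost of a geometric series of ratio
  \<open>(1/4) powr \<alpha>\<close>.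
\<close>
lemma saturated_sum_bound:
  fixes c :: "nat \<Rightarrow> real"
  assumes c: "\<And>n. 0 \<le> c n" and "0 < \<alpha>" "0 \<le> K" and \<delta>: "0 < \<delta>" "\<delta> < d" and d: "d \<le> 1"
    and part: "\<And>\<eta>. 0 < \<eta> \<Longrightarrow> \<eta> < d \<Longrightarrow>
       (\<Sum>n\<le>M. if n * \<eta> \<le> 1 / 2 then (n * \<eta>)\<^sup>2 * c n else 0) \<le> K * (\<eta> powr \<alpha>)\<^sup>2"
  shows "(\<Sum>n\<le>M. min 1 ((n * \<delta>)\<^sup>2) * c n) \<le> 16 * K / (1 - (1 / 4) powr \<alpha>) * (\<delta> powr \<alpha>)\<^sup>2"
proof -
  define q :: real where "q = (1 / 4) powr \<alpha>"
  have q: "0 < q" "q < 1"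
    using \<open>0 < \<alpha>\<close> powr_less_mono2[of \<alpha> "1/4" 1] by (auto simp: q_def)
  have "(\<Sum>n\<le>M. min 1 ((n * \<delta>)\<^sup>2) * c n)
     \<le> (\<Sum>n\<le>M. (\<Sum>k\<le>M. if n * (\<delta> / 2 ^ k) \<le> 1 / 2 then 16 * (n * (\<delta> / 2 ^ k))\<^sup>2 else 0) * c n)"
    using \<delta> d c by (intro sum_mono mult_right_mono min_one_square_le_dyadic_sum) auto
  also have "\<dots> = (\<Sum>k\<le>M. 16 * (\<Sum>n\<le>M. if n * (\<delta> / 2 ^ k) \<le> 1 / 2 then (n * (\<delta> / 2 ^ k))\<^sup>2 * c n else 0))"
    unfolding sum_distrib_right sum_distrib_left
    by (subst sum.swap) (intro sum.cong refl, simp)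
  also have "\<dots> \<le> (\<Sum>k\<le>M. 16 * (K * ((\<delta> / 2 ^ k) powr \<alpha>)\<^sup>2))"
  proof (intro sum_mono mult_left_mono part)
    fix k :: nat
    have "\<delta> / 2 ^ k \<le> \<delta> / 1" using \<delta> by (intro divide_left_mono) auto
    then show "\<delta> / 2 ^ k < d" using \<delta> by simp
  qed (use \<delta> in auto)
  also have "\<dots> = (\<Sum>k\<le>M. 16 * K * (\<delta> powr \<alpha>)\<^sup>2 * q ^ k)"
  proof (intro sum.cong refl)
    fix k :: nat
    have "((1 / 2 ^ k) powr \<alpha>)\<^sup>2 = ((1 / 2) ^ k) powr \<alpha> * ((1 / 2) ^ k) powr \<alpha>"
      by (simp add: power2_eq_square power_one_over)
    also have "\<dots> = ((1 / 4) ^ k) powr \<alpha>"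
      by (subst powr_mult[symmetric]) (auto simp flip: power_mult_distrib)
    also have "\<dots> = q ^ k"
      unfolding q_def by (simp add: powr_realpow[symmetric] powr_powr mult.commute powr_power)
    finally have *: "((1 / 2 ^ k) powr \<alpha>)\<^sup>2 = q ^ k" .
    have "(\<delta> / 2 ^ k) powr \<alpha> = \<delta> powr \<alpha> * (1 / 2 ^ k) powr \<alpha>"
      using \<delta> powr_mult[of \<delta> "1 / 2 ^ k" \<alpha>] by simp
    then show "16 * (K * ((\<delta> / 2 ^ k) powr \<alpha>)\<^sup>2) = 16 * K * (\<delta> powr \<alpha>)\<^sup>2 * q ^ k"
      by (simp only: power_mult_distrib * mult_ac)
  qed
  also have "\<dots> = 16 * K * (\<delta> powr \<alpha>)\<^sup>2 * (\<Sum>k\<le>M. q ^ k)"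
    by (simp add: sum_distrib_left)
  also have "\<dots> \<le> 16 * K * (\<delta> powr \<alpha>)\<^sup>2 * (1 / (1 - q))"
  proof (rule mult_left_mono)
    have "(\<Sum>k\<le>M. q ^ k) \<le> (\<Sum>k. q ^ k)"
      using q by (intro sum_le_suminf summable_geometric) auto
    then show "(\<Sum>k\<le>M. q ^ k) \<le> 1 / (1 - q)"
      using q by (simp add: suminf_geometric)
  qed (use \<open>0 \<le> K\<close> in auto)
  finally show ?thesis by (simp add: q_def mult_ac)
qed

lemma summable_saturating_weight:
  fixes c :: "nat \<Rightarrow> real"
  assumes "saturating_weight w" "\<And>n. 0 \<le> c n" "summable c" "0 < \<delta>" "\<delta> < 1"
  shows "summable (\<lambda>n. w \<delta> n * c n)"
proof -
  obtain hi where hi: "0 < hi" "\<And>n. 0 \<le> w \<delta> n" "\<And>n. w \<delta> n \<le> hi * min 1 ((n * \<delta>)\<^sup>2)"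
    using assms(1,4,5) unfolding saturating_weight_def by (meson greaterThanLessThan_iff)
  have "w \<delta> n \<le> hi" for n
  proof -
    have "hi * min 1 ((n * \<delta>)\<^sup>2) \<le> hi * 1" using hi(1) by (intro mult_left_mono) auto
    then show ?thesis using hi(3)[of n] by linarith
  qed
  then show ?thesis
    using hi(2) assms(2)
    by (intro summable_comparison_test'[OF summable_mult[OF assms(3), of hi], of 0])
       (auto simp: abs_mult intro!: mult_right_mono)
qed

text \<open>
  Squaring turns a growth condition on a norm into one on the weighted sum itself. The range
  \<open>d \<le> 1\<close> keeps \<open>\<delta>\<close> in the interval on which the weights are controlled.
\<close>
lemma bigo_at_right_0_sqrt_iff:
  fixes Q :: "real \<Rightarrow> real"
  assumes "\<And>\<delta>. 0 < \<delta> \<Longrightarrow> \<delta> < 1 \<Longrightarrow> 0 \<le> Q \<delta>"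
  shows "(\<lambda>\<delta>. sqrt (Q \<delta>)) \<in> O[at_right 0](\<lambda>\<delta>. \<delta> powr \<alpha>) \<longleftrightarrow>
    (\<exists>K\<ge>0. \<exists>d\<in>{0<..1}. \<forall>\<delta>. 0 < \<delta> \<longrightarrow> \<delta> < d \<longrightarrow> Q \<delta> \<le> K * (\<delta> powr \<alpha>)\<^sup>2)"
    (is "?L \<longleftrightarrow> ?R")
proof
  assume ?L
  then obtain C where C: "C > 0" "eventually (\<lambda>\<delta>. norm (sqrt (Q \<delta>)) \<le> C * norm (\<delta> powr \<alpha>)) (at_right 0)"
    by (rule landau_o.bigE)
  then obtain d0 where d0: "d0 > 0" "\<And>\<delta>. 0 < \<delta> \<Longrightarrow> \<delta> < d0 \<Longrightarrow> sqrt (Q \<delta>) \<le> C * \<delta> powr \<alpha>"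
    unfolding eventually_at_right_field by fastforce
  show ?R
  proof (intro exI[of _ "C\<^sup>2"] conjI bexI[of _ "min d0 1"] allI impI)
    fix \<delta> :: real assume "0 < \<delta>" "\<delta> < min d0 1"
    then have Q: "sqrt (Q \<delta>) \<le> C * \<delta> powr \<alpha>" "0 \<le> Q \<delta>"
      using assms d0 by auto
    have "(sqrt (Q \<delta>))\<^sup>2 \<le> (C * \<delta> powr \<alpha>)\<^sup>2"
      by (rule power_mono[OF Q(1)]) (use Q(2) in simp)
    with Q(2) show "Q \<delta> \<le> C\<^sup>2 * (\<delta> powr \<alpha>)\<^sup>2" by (simp add: power_mult_distrib)
  qed (use d0 in auto)
next
  assume ?R
  then obtain K d where K: "K \<ge> 0" "0 < d" "d \<le> 1"
    "\<And>\<delta>. 0 < \<delta> \<Longrightarrow> \<delta> < d \<Longrightarrow> Q \<delta> \<le> K * (\<delta> powr \<alpha>)\<^sup>2" by auto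
  show ?L
  proof (rule landau_o.bigI[of "sqrt K + 1"])
    show "eventually (\<lambda>\<delta>. norm (sqrt (Q \<delta>)) \<le> (sqrt K + 1) * norm (\<delta> powr \<alpha>)) (at_right 0)"
      unfolding eventually_at_right_field
    proof (intro exI[of _ d] conjI allI impI)
      fix \<delta> :: real assume \<delta>: "0 < \<delta>" "\<delta> < d"
      have "sqrt (Q \<delta>) \<le> sqrt (K * (\<delta> powr \<alpha>)\<^sup>2)"
        using K \<delta> by simp
      also have "\<dots> = sqrt K * \<delta> powr \<alpha>" by (simp add: real_sqrt_mult)
      also have "\<dots> \<le> (sqrt K + 1) * \<delta> powr \<alpha>" by (simp add: mult_right_mono)
      finally show "norm (sqrt (Q \<delta>)) \<le> (sqrt K + 1) * norm (\<delta> powr \<alpha>)"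
        using assms[of \<delta>] \<delta> K by simp
    qed (use K in simp)
  qed (use K in \<open>simp add: add_nonneg_pos\<close>)
qed

text \<open>
  The lower bound on \<open>w\<close> controls the truncated sums, these control the sum with weight
  \<open>min 1 ((n * \<delta>)\<^sup>2)\<close>, and the latter dominates the sum with weight \<open>v\<close>.
\<close>
lemma saturating_weight_transfer:
  fixes c :: "nat \<Rightarrow> real"
  assumes w: "saturating_weight w" and v: "saturating_weight v"
    and c: "\<And>n. 0 \<le> c n" "summable c" and "0 < \<alpha>"
    and O: "(\<lambda>\<delta>. sqrt (\<Sum>n. w \<delta> n * c n)) \<in> O[at_right 0](\<lambda>\<delta>. \<delta> powr \<alpha>)"
  shows "(\<lambda>\<delta>. sqrt (\<Sum>n. v \<delta> n * c n)) \<in> O[at_right 0](\<lambda>\<delta>. \<delta> powr \<alpha>)"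
proof -
  obtain lo where lo: "0 < lo" "\<And>\<delta> n. 0 < \<delta> \<Longrightarrow> \<delta> < 1 \<Longrightarrow> 0 \<le> w \<delta> n"
    "\<And>\<delta> n. 0 < \<delta> \<Longrightarrow> \<delta> < 1 \<Longrightarrow> n * \<delta> \<le> 1 / 2 \<Longrightarrow> lo * (n * \<delta>)\<^sup>2 \<le> w \<delta> n"
    using w unfolding saturating_weight_def by (meson greaterThanLessThan_iff)
  obtain hi where hi: "0 < hi" "\<And>\<delta> n. 0 < \<delta> \<Longrightarrow> \<delta> < 1 \<Longrightarrow> 0 \<le> v \<delta> n"
    "\<And>\<delta> n. 0 < \<delta> \<Longrightarrow> \<delta> < 1 \<Longrightarrow> v \<delta> n \<le> hi * min 1 ((n * \<delta>)\<^sup>2)"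
    using v unfolding saturating_weight_def by (meson greaterThanLessThan_iff)
  note sw = summable_saturating_weight[OF w c]
  note sv = summable_saturating_weight[OF v c]
  have w0: "0 \<le> (\<Sum>n. w \<delta> n * c n)" if "0 < \<delta>" "\<delta> < 1" for \<delta>
    using that lo(2) c(1) by (intro suminf_nonneg sw) auto
  have v0: "0 \<le> (\<Sum>n. v \<delta> n * c n)" if "0 < \<delta>" "\<delta> < 1" for \<delta>
    using that hi(2) c(1) by (intro suminf_nonneg sv) auto
  have "\<exists>K\<ge>0. \<exists>d\<in>{0<..1}. \<forall>\<delta>. 0 < \<delta> \<longrightarrow> \<delta> < d \<longrightarrow> (\<Sum>n. w \<delta> n * c n) \<le> K * (\<delta> powr \<alpha>)\<^sup>2"
    by (rule iffD1[OF bigo_at_right_0_sqrt_iff O]) (rule w0)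
  then obtain K d where K: "0 \<le> K" "0 < d" "d \<le> 1"
    and bound: "\<And>\<delta>. 0 < \<delta> \<Longrightarrow> \<delta> < d \<Longrightarrow> (\<Sum>n. w \<delta> n * c n) \<le> K * (\<delta> powr \<alpha>)\<^sup>2"
    by auto
  have part: "(\<Sum>n\<le>M. if n * \<eta> \<le> 1 / 2 then (n * \<eta>)\<^sup>2 * c n else 0) \<le> K / lo * (\<eta> powr \<alpha>)\<^sup>2"
    if \<eta>: "0 < \<eta>" "\<eta> < d" for \<eta> M
  proof -
    have "lo * (\<Sum>n\<le>M. if n * \<eta> \<le> 1 / 2 then (n * \<eta>)\<^sup>2 * c n else 0) \<le> (\<Sum>n\<le>M. w \<eta> n * c n)"
      unfolding sum_distrib_left
    proof (rule sum_mono)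
      fix n
      show "lo * (if n * \<eta> \<le> 1 / 2 then (n * \<eta>)\<^sup>2 * c n else 0) \<le> w \<eta> n * c n"
        using lo(2)[of \<eta> n] mult_right_mono[OF lo(3)[of \<eta> n] c(1)[of n]] \<eta> K c(1)[of n]
        by (auto simp: mult_ac)
    qed
    also have "\<dots> \<le> (\<Sum>n. w \<eta> n * c n)"
      using \<eta> K lo(2) c(1) by (intro sum_le_suminf sw) auto
    also have "\<dots> \<le> K * (\<eta> powr \<alpha>)\<^sup>2"
      using \<eta> by (rule bound)
    finally show ?thesis using lo(1) by (simp add: field_simps)
  qed
  \<comment> \<open>The constant of \<open>saturated_sum_bound\<close> for the bound \<open>K / lo\<close> on the truncated sums.\<close>
  define L where "L = 16 * (K / lo) / (1 - (1 / 4) powr \<alpha>)"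
  have "(1 / 4) powr \<alpha> < (1 :: real)"
    using \<open>0 < \<alpha>\<close> powr_less_mono2[of \<alpha> "1/4" 1] by auto
  then have "0 \<le> L" unfolding L_def using K lo(1) by (intro divide_nonneg_nonneg) auto
  have "(\<Sum>n. v \<delta> n * c n) \<le> hi * L * (\<delta> powr \<alpha>)\<^sup>2" if \<delta>: "0 < \<delta>" "\<delta> < d" for \<delta>
  proof (rule suminf_le_const)
    show "summable (\<lambda>n. v \<delta> n * c n)" using \<delta> K by (intro sv) auto
    fix N
    have "(\<Sum>n<N. v \<delta> n * c n) \<le> (\<Sum>n\<le>N. v \<delta> n * c n)"
      using \<delta> K hi(2) c(1) by (intro sum_mono2) auto
    also have "\<dots> \<le> (\<Sum>n\<le>N. hi * (min 1 ((n * \<delta>)\<^sup>2) * c n))"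
      using \<delta> K mult_right_mono[OF hi(3) c(1)] by (intro sum_mono) (simp add: mult.assoc)
    also have "\<dots> = hi * (\<Sum>n\<le>N. min 1 ((n * \<delta>)\<^sup>2) * c n)"
      by (simp add: sum_distrib_left)
    also have "\<dots> \<le> hi * (L * (\<delta> powr \<alpha>)\<^sup>2)"
      unfolding L_def using \<delta> K lo(1) hi(1) \<open>0 < \<alpha>\<close> c(1)
      by (intro mult_left_mono saturated_sum_bound[where d = d] part) auto
    finally show "(\<Sum>n<N. v \<delta> n * c n) \<le> hi * L * (\<delta> powr \<alpha>)\<^sup>2" by simp
  qed
  then have "\<exists>K\<ge>0. \<exists>d\<in>{0<..1}. \<forall>\<delta>. 0 < \<delta> \<longrightarrow> \<delta> < d \<longrightarrow> (\<Sum>n. v \<delta> n * c n) \<le> K * (\<delta> powr \<alpha>)\<^sup>2"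
    using \<open>0 \<le> L\<close> hi(1) K by (intro exI[of _ "hi * L"] conjI bexI[of _ d]) auto
  with v0 show ?thesis
    using bigo_at_right_0_sqrt_iff[of "\<lambda>\<delta>. \<Sum>n. v \<delta> n * c n" \<alpha>] by blast
qed

section \<open>The weights of rotations and dilations\<close>

lemma half_le_sin:
  fixes x :: real
  assumes "0 \<le> x" "x \<le> 1 / 2"
  shows "x / 2 \<le> sin x"
proof -
  have "sin 0 - 0 / 2 \<le> sin x - x / 2"
  proof (rule DERIV_nonneg_imp_nondecreasing[OF assms(1)])
    fix y :: real assume y: "0 \<le> y" "y \<le> x"
    have "cos (pi / 3) \<le> cos y"
      using y assms pi_gt3 by (intro cos_monotone_0_pi_le) auto
    then have "0 \<le> cos y - 1 / 2" by (simp add: cos_60)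
    moreover have "((\<lambda>y. sin y - y / 2) has_real_derivative cos y - 1 / 2) (at y)"
      by (auto intro!: derivative_eq_intros)
    ultimately show "\<exists>D. ((\<lambda>y. sin y - y / 2) has_real_derivative D) (at y) \<and> 0 \<le> D"
      by blast
  qed
  then show ?thesis by simp
qed

lemma saturating_weight_rotation:
  "saturating_weight (\<lambda>\<delta> n. (cmod (exp (\<i> * of_real \<delta>) ^ n - 1))\<^sup>2)"
proof (rule saturating_weightI[where lo = "1 / 4" and hi = 4])
  fix \<delta> :: real and n :: nat assume \<delta>: "0 < \<delta>" "\<delta> < 1"
  define x where "x = n * \<delta>"
  have x0: "0 \<le> x" using \<delta> by (simp add: x_def)
  have e: "exp (\<i> * of_real \<delta>) ^ n = cis x"
    by (simp add: x_def cis_conv_exp exp_of_nat_mult[symmetric] mult_ac)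
  have "cmod (cis x - 1) \<le> 2"
    using norm_triangle_ineq4[of "cis x" 1] by simp
  then have "(cmod (cis x - 1))\<^sup>2 \<le> 2\<^sup>2" by (rule power_mono) simp
  then show "(cmod (exp (\<i> * of_real \<delta>) ^ n - 1))\<^sup>2 \<le> 4" by (simp add: e)
  have "cmod (cis x - 1) = 2 * \<bar>sin (x / 2)\<bar>"
    by (simp add: dist_exp_i_1 cis_conv_exp)
  also have "\<dots> \<le> x" using abs_sin_x_le_abs_x[of "x / 2"] x0 by simp
  finally have "cmod (cis x - 1) \<le> x" .
  then have "(cmod (cis x - 1))\<^sup>2 \<le> x\<^sup>2" by (rule power_mono) simp
  then show "(cmod (exp (\<i> * of_real \<delta>) ^ n - 1))\<^sup>2 \<le> 4 * (n * \<delta>)\<^sup>2"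
    unfolding e x_def[symmetric] by (rule order_trans) simp
  show "1 / 4 * (n * \<delta>)\<^sup>2 \<le> (cmod (exp (\<i> * of_real \<delta>) ^ n - 1))\<^sup>2" if "n * \<delta> \<le> 1 / 2"
  proof -
    have "x / 2 \<le> \<bar>sin x\<bar>"
      using half_le_sin[of x] x0 that by (simp add: x_def)
    also have "\<dots> \<le> cmod (cis x - 1)" using abs_Im_le_cmod[of "cis x - 1"] by simp
    finally have "(x / 2)\<^sup>2 \<le> (cmod (cis x - 1))\<^sup>2" using x0 by (intro power_mono) auto
    then show ?thesis unfolding e x_def[symmetric] by (simp add: power_divide)
  qed
qed simp_all

text \<open>
  Both are Bernoulli's inequality; the second one uses \<open>1 + n * \<delta> \<le> (1 + \<delta>) ^ n\<close> and
  \<open>(1 + \<delta>) * (1 - \<delta>) \<le> 1\<close>.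
\<close>
lemma one_minus_power_bounds:
  fixes \<delta> :: real
  assumes "0 < \<delta>" "\<delta> < 1"
  shows "1 - n * \<delta> \<le> (1 - \<delta>) ^ n" and "(1 + n * \<delta>) * (1 - \<delta>) ^ n \<le> 1"
proof -
  show "1 - n * \<delta> \<le> (1 - \<delta>) ^ n"
    using Bernoulli_inequality[of "- \<delta>" n] assms by simp
  have "(1 + n * \<delta>) * (1 - \<delta>) ^ n \<le> (1 + \<delta>) ^ n * (1 - \<delta>) ^ n"
    using Bernoulli_inequality[of \<delta> n] assms by (intro mult_right_mono) auto
  also have "\<dots> = (1 - \<delta>\<^sup>2) ^ n"
    by (simp add: power_mult_distrib[symmetric] power2_eq_square algebra_simps)
  also have "\<dots> \<le> 1"
    using assms by (intro power_le_one) (auto simp: power_le_one)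
  finally show "(1 + n * \<delta>) * (1 - \<delta>) ^ n \<le> 1" .
qed

lemma saturating_weight_dilation:
  "saturating_weight (\<lambda>\<delta> n. ((1 - \<delta>) ^ n - 1)\<^sup>2)"
proof (rule saturating_weightI[where lo = "1 / 4" and hi = 1])
  fix \<delta> :: real and n :: nat assume \<delta>: "0 < \<delta>" "\<delta> < 1"
  define x where "x = n * \<delta>"
  define p where "p = (1 - \<delta>) ^ n"
  have x0: "0 \<le> x" using \<delta> by (simp add: x_def)
  have p: "0 \<le> p" "p \<le> 1" "1 - x \<le> p" "(1 + x) * p \<le> 1"
    using \<delta> one_minus_power_bounds[OF \<delta>, of n] by (auto simp: p_def x_def power_le_one)
  have "(1 - p)\<^sup>2 \<le> 1\<^sup>2" "(1 - p)\<^sup>2 \<le> x\<^sup>2"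
    using p by (auto intro!: power_mono simp: power_le_one)
  then show "((1 - \<delta>) ^ n - 1)\<^sup>2 \<le> 1" "((1 - \<delta>) ^ n - 1)\<^sup>2 \<le> 1 * (n * \<delta>)\<^sup>2"
    unfolding x_def[symmetric] p_def[symmetric] by (simp_all add: power2_commute)
  show "1 / 4 * (n * \<delta>)\<^sup>2 \<le> ((1 - \<delta>) ^ n - 1)\<^sup>2" if "n * \<delta> \<le> 1 / 2"
  proof -
    have x: "x \<le> 1 / 2" using that by (simp add: x_def)
    have "x * (1 / 2) \<le> x * p" using x0 x p by (intro mult_left_mono) auto
    then have "x / 2 \<le> 1 - p" using p(4) by (simp add: algebra_simps)
    then have "(x / 2)\<^sup>2 \<le> (1 - p)\<^sup>2" using x0 by (intro power_mono) auto
    then show ?thesis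
      unfolding x_def[symmetric] p_def[symmetric] by (simp add: power_divide power2_commute)
  qed
qed simp_all

text \<open>
  The weight of \<open>\<delta>\<close> times the Dirichlet norm of the dilation by \<open>1 - \<delta>\<close> of \<open>f'\<close>. The value at
  \<open>n = 1\<close> comes from \<open>f' 0 = a 1\<close>, since the Dirichlet norm adds the constant term separately. The
  factor \<open>\<delta>\<^sup>2\<close> turns the exponent \<open>\<alpha> - 1\<close> into \<open>\<alpha>\<close>.
\<close>
definition dilated_derivative_weight :: "real \<Rightarrow> nat \<Rightarrow> real" where
  "dilated_derivative_weight \<delta> n =
     \<delta>\<^sup>2 * (if n = 1 then 1 else real (n * (n - 1)) * (1 - \<delta>) ^ (2 * (n - 1)))"

text \<open>
  Boundedness comes from \<open>m * \<delta> * (1 - \<delta>) ^ m \<le> 1\<close>, applied with \<open>m = n - 1\<close>.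
\<close>
lemma saturating_weight_dilated_derivative: "saturating_weight dilated_derivative_weight"
    (is "saturating_weight ?w")
proof (rule saturating_weightI[where lo = "1 / 8" and hi = 2])
  fix \<delta> :: real and n :: nat assume \<delta>: "0 < \<delta>" "\<delta> < 1"
  show nn: "0 \<le> ?w \<delta> n" using \<delta> by (simp add: dilated_derivative_weight_def)
  consider "n = 0" | "n = 1" | m where "n = Suc m" "m \<ge> 1"
    by (cases n) force+
  then have "?w \<delta> n \<le> 2 \<and> ?w \<delta> n \<le> 2 * (n * \<delta>)\<^sup>2 \<and> (n * \<delta> \<le> 1 / 2 \<longrightarrow> 1 / 8 * (n * \<delta>)\<^sup>2 \<le> ?w \<delta> n)"
  proof cases
    case 2
    have "\<delta>\<^sup>2 \<le> 1" using \<delta> by (simp add: power_le_one)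
    with 2 show ?thesis by (simp add: dilated_derivative_weight_def)
  next
    case 3
    define p where "p = (1 - \<delta>) ^ m"
    have p: "0 \<le> p" "p \<le> 1" "1 - m * \<delta> \<le> p" "(1 + m * \<delta>) * p \<le> 1"
      using \<delta> one_minus_power_bounds[OF \<delta>, of m] by (auto simp: p_def power_le_one)
    have w: "?w \<delta> n = (m * (m + 1)) * (\<delta> * p)\<^sup>2"
      using 3 by (simp add: dilated_derivative_weight_def p_def power_mult_distrib
          power_mult[symmetric] mult_ac)
    have "m * \<delta> * p \<le> 1" using p by (simp add: algebra_simps)
    then have "(m * \<delta> * p)\<^sup>2 \<le> 1\<^sup>2" using \<delta> p by (intro power_mono) auto
    moreover have "m * (m + 1) * (\<delta> * p)\<^sup>2 \<le> 2 * (m * m) * (\<delta> * p)\<^sup>2"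
    proof (rule mult_right_mono)
      have "m * (m + 1) \<le> 2 * (m * m)" using 3 by simp
      then show "real (m * (m + 1)) \<le> 2 * (m * m)"
        by (metis of_nat_le_iff of_nat_mult of_nat_numeral)
    qed simp
    ultimately have 1: "?w \<delta> n \<le> 2" unfolding w by (simp add: power2_eq_square mult_ac)
    have "(\<delta> * p)\<^sup>2 \<le> \<delta>\<^sup>2" using \<delta> p by (intro power_mono) (auto intro: mult_left_le)
    then have "m * (m + 1) * (\<delta> * p)\<^sup>2 \<le> 2 * n\<^sup>2 * \<delta>\<^sup>2"
    proof (intro mult_mono)
      have "m * (m + 1) \<le> 2 * n\<^sup>2"
        using 3 by (simp add: power2_eq_square)
      then show "real (m * (m + 1)) \<le> real (2 * n\<^sup>2)" by (simp only: of_nat_le_iff)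
    qed simp_all
    then have 2: "?w \<delta> n \<le> 2 * (n * \<delta>)\<^sup>2" unfolding w by (simp add: power_mult_distrib)
    have 3: "1 / 8 * (n * \<delta>)\<^sup>2 \<le> ?w \<delta> n" if "n * \<delta> \<le> 1 / 2"
    proof -
      have "m * \<delta> \<le> n * \<delta>" using 3 \<delta> by simp
      then have "1 / 2 \<le> p" using that p by simp
      then have "(\<delta> * (1 / 2))\<^sup>2 \<le> (\<delta> * p)\<^sup>2" using \<delta> by (intro power_mono mult_left_mono) auto
      moreover have "n\<^sup>2 / 2 \<le> real (m * (m + 1))"
        using 3 mult_le_mono[of 1 m 1 m]
        by (simp add: power2_eq_square field_simps flip: of_nat_mult)
      ultimately have "n\<^sup>2 / 2 * (\<delta> * (1 / 2))\<^sup>2 \<le> m * (m + 1) * (\<delta> * p)\<^sup>2"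
        by (intro mult_mono) auto
      then show ?thesis unfolding w by (simp add: power_mult_distrib power_divide)
    qed
    show ?thesis using 1 2 3 by blast
  qed (simp add: dilated_derivative_weight_def)
  then show "?w \<delta> n \<le> 2" "?w \<delta> n \<le> 2 * (n * \<delta>)\<^sup>2"
    "n * \<delta> \<le> 1 / 2 \<Longrightarrow> 1 / 8 * (n * \<delta>)\<^sup>2 \<le> ?w \<delta> n" by blast+
qed simp_all

section \<open>Equivalence of the three growth conditions\<close>

lemma bigo_at_left_1_iff:
  fixes F g :: "real \<Rightarrow> real"
  shows "F \<in> O[at_left 1](g) \<longleftrightarrow> (\<lambda>\<delta>. F (1 - \<delta>)) \<in> O[at_right 0](\<lambda>\<delta>. g (1 - \<delta>))"
proof -
  have "eventually P (at_left 1) \<longleftrightarrow> eventually (\<lambda>\<delta>. P (1 - \<delta>)) (at_right 0)" for P :: "real \<Rightarrow> bool"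
  proof -
    have "at_left 1 = filtermap uminus (filtermap (\<lambda>\<delta>. \<delta> - 1) (at_right (0::real)))"
      using filtermap_at_right_shift[of 1 "0::real"] at_left_minus[of "1::real"] by simp
    then have "at_left 1 = filtermap (\<lambda>\<delta>. 1 - \<delta>) (at_right (0::real))"
      by (simp add: filtermap_filtermap)
    then show ?thesis by (simp add: eventually_filtermap)
  qed
  then show ?thesis by (simp add: bigo_def)
qed

lemma bigo_at_0_abs_iff:
  fixes F g :: "real \<Rightarrow> real"
  assumes "\<And>t. F t = G \<bar>t\<bar>"
  shows "F \<in> O[at 0](\<lambda>t. g \<bar>t\<bar>) \<longleftrightarrow> G \<in> O[at_right 0](g)"
proof -
  have "eventually (\<lambda>t. P \<bar>t\<bar>) (at 0) \<longleftrightarrow> eventually P (at_right 0)" for P :: "real \<Rightarrow> bool"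
  proof
    assume "eventually (\<lambda>t. P \<bar>t\<bar>) (at 0)"
    then have "eventually (\<lambda>t. P \<bar>t\<bar>) (at_right 0)" by (simp add: eventually_at_split)
    moreover have "eventually (\<lambda>t. t > 0) (at_right (0::real))" by (rule eventually_at_right_less)
    ultimately show "eventually P (at_right 0)" by eventually_elim simp
  next
    assume "eventually P (at_right 0)"
    then obtain d where "d > 0" "\<And>t. 0 < t \<Longrightarrow> t < d \<Longrightarrow> P t"
      unfolding eventually_at_right_field by auto
    then show "eventually (\<lambda>t. P \<bar>t\<bar>) (at 0)"
      unfolding eventually_at by (intro exI[of _ d]) auto
  qed
  from this[of "\<lambda>t. norm (G t) \<le> c * norm (g t)" for c] show ?thesis
    by (simp add: bigo_def assms)
qed

text \<open>
  This covers rotations, with \<open>\<bar>u\<bar> = 1\<close>, and dilations, with \<open>0 \<le> u \<le> 1\<close>, at once. The difference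
  vanishes at 0, so only the weighted sum remains.
\<close>
lemma dirichlet_norm_multiplier_difference:
  fixes a :: "nat \<Rightarrow> complex"
  assumes f: "\<And>z. z \<in> unit_disc \<Longrightarrow> (\<lambda>n. a n * z ^ n) sums f z"
    and sm: "summable (\<lambda>n. n * (cmod (a n))\<^sup>2)" and u: "cmod u \<le> 1"
  shows "dirichlet_norm (\<lambda>z. f (u * z) - f z) = sqrt (\<Sum>n. (cmod (u ^ n - 1))\<^sup>2 * (n * (cmod (a n))\<^sup>2))"
proof -
  define b where "b = (\<lambda>n. (u ^ n - 1) * a n)"
  have b: "(\<lambda>n. b n * z ^ n) sums (f (u * z) - f z)" if z: "z \<in> unit_disc" for z
  proof -
    have "cmod u * cmod z \<le> 1 * cmod z" using u by (intro mult_right_mono) auto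
    then have "u * z \<in> unit_disc" using z by (simp add: norm_mult)
    from sums_diff[OF f[OF this] f[OF z]] show ?thesis
      by (simp add: b_def power_mult_distrib algebra_simps)
  qed
  have eq: "n * (cmod (b n))\<^sup>2 = (cmod (u ^ n - 1))\<^sup>2 * (n * (cmod (a n))\<^sup>2)" for n
    by (simp add: b_def norm_mult power_mult_distrib)
  have "summable (\<lambda>n. n * (cmod (b n))\<^sup>2)"
  proof (rule summable_comparison_test'[OF summable_mult[OF sm, of 4], of 0])
    fix n
    have "cmod (u ^ n - 1) \<le> 2"
      using norm_triangle_ineq4[of "u ^ n" 1] u power_le_one[of "cmod u" n] by (simp add: norm_power)
    then have "(cmod (u ^ n - 1))\<^sup>2 \<le> 2\<^sup>2" by (rule power_mono) simp
    then have "(cmod (u ^ n - 1))\<^sup>2 * (n * (cmod (a n))\<^sup>2) \<le> 4 * (n * (cmod (a n))\<^sup>2)"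
      by (intro mult_right_mono) auto
    then show "norm (n * (cmod (b n))\<^sup>2) \<le> 4 * (n * (cmod (a n))\<^sup>2)"
      unfolding eq by (simp add: abs_mult)
  qed
  from dirichlet_norm_power_series[of b "\<lambda>z. f (u * z) - f z", OF b this] show ?thesis
    unfolding eq by (simp add: b_def)
qed

lemma dilation_norm_deriv:
  fixes a :: "nat \<Rightarrow> complex" and \<delta> :: real
  assumes d: "\<And>z. z \<in> unit_disc \<Longrightarrow> (\<lambda>n. diffs a n * z ^ n) sums deriv f z"
    and sm: "summable (\<lambda>n. n * (cmod (a n))\<^sup>2)" and \<delta>: "0 < \<delta>" "\<delta> < 1"
  shows "\<delta> * dilation_norm (1 - \<delta>) (deriv f) =
    sqrt (\<Sum>n. dilated_derivative_weight \<delta> n * (n * (cmod (a n))\<^sup>2))"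
proof -
  define W where "W = (\<lambda>n::nat. if n = 1 then 1 else real (n * (n - 1)) * (1 - \<delta>) ^ (2 * (n - 1)))"
  define c where "c = (\<lambda>n. n * (cmod (a n))\<^sup>2)"
  define b where "b = (\<lambda>n. diffs a n * of_real (1 - \<delta>) ^ n)"
  have b: "(\<lambda>n. b n * z ^ n) sums dilation (1 - \<delta>) (deriv f) z" if z: "z \<in> unit_disc" for z
  proof -
    have "\<bar>1 - \<delta>\<bar> * cmod z \<le> 1 * cmod z" using \<delta> by (intro mult_right_mono) auto
    then have "of_real (1 - \<delta>) * z \<in> unit_disc" using z by (simp add: norm_mult del: of_real_diff)
    from d[OF this] show ?thesis
      by (simp add: b_def dilation_def power_mult_distrib mult_ac)
  qed
  have "summable (\<lambda>n. \<delta>\<^sup>2 * W n * c n)"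
    using summable_saturating_weight[OF saturating_weight_dilated_derivative _ sm \<delta>]
    by (simp add: W_def c_def dilated_derivative_weight_def)
  from summable_mult[OF this, of "1 / \<delta>\<^sup>2"] have sW: "summable (\<lambda>n. W n * c n)"
    using \<delta> by simp
  \<comment> \<open>Differentiation shifts the coefficients by one. The index \<open>n = 0\<close> is exceptional because
    \<open>W 1 = 1\<close>, whereas the weight \<open>n\<close> on the left vanishes there.\<close>
  have eq: "n * (cmod (b n))\<^sup>2 = (if n = 0 then 0 else W (Suc n) * c (Suc n))" for n
  proof -
    have "cmod (b n) = Suc n * cmod (a (Suc n)) * (1 - \<delta>) ^ n"
      using \<delta> by (simp add: b_def diffs_def norm_mult norm_power del: of_nat_Suc of_real_diff)
    then have "(cmod (b n))\<^sup>2 = (Suc n)\<^sup>2 * (cmod (a (Suc n)))\<^sup>2 * (1 - \<delta>) ^ (2 * n)"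
      by (simp only: power_mult_distrib power_even_eq of_nat_power)
    then show ?thesis
      by (simp add: W_def c_def power2_eq_square[of "real (Suc n)"] del: of_nat_Suc)
         (simp add: algebra_simps)
  qed
  have c0: "c 0 = 0" by (simp add: c_def)
  have b0: "(cmod (b 0))\<^sup>2 = W 1 * c 1"
    by (simp add: b_def diffs_def W_def c_def)
  have "summable (\<lambda>n. W (Suc n) * c (Suc n))"
    using iffD2[OF summable_Suc_iff[of "\<lambda>n. W n * c n"] sW] .
  then have sb: "summable (\<lambda>n. n * (cmod (b n))\<^sup>2)"
    by (rule iffD2[OF summable_cong, rotated])
       (auto simp: eq eventually_sequentially intro!: exI[of _ 1])
  have "dilation_norm (1 - \<delta>) (deriv f) = sqrt ((cmod (b 0))\<^sup>2 + (\<Sum>n. n * (cmod (b n))\<^sup>2))"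
    unfolding dilation_norm_def by (rule dirichlet_norm_power_series[OF b sb])
  \<comment> \<open>The terms of index 0 and 1 of \<open>W n * c n\<close> are 0 and \<open>\<bar>b 0\<bar>\<^sup>2\<close>.\<close>
  also have "(\<Sum>n. n * (cmod (b n))\<^sup>2) = (\<Sum>n. W (Suc (Suc n)) * c (Suc (Suc n)))"
    using suminf_split_head[OF sb] unfolding eq by simp
  also have "(cmod (b 0))\<^sup>2 + \<dots> = (\<Sum>n. W n * c n)"
    using suminf_split_initial_segment[OF sW, of 2] c0 unfolding b0 by (simp add: numeral_2_eq_2)
  finally have "\<delta> * dilation_norm (1 - \<delta>) (deriv f) = sqrt (\<delta>\<^sup>2 * (\<Sum>n. W n * c n))"
    using \<delta> by (simp add: real_sqrt_mult)
  also have "\<delta>\<^sup>2 * (\<Sum>n. W n * c n) = (\<Sum>n. \<delta>\<^sup>2 * W n * c n)"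
    using sW by (simp add: suminf_mult[symmetric] mult.assoc)
  finally show ?thesis by (simp add: W_def c_def dilated_derivative_weight_def)
qed

theorem theorem4p2:
  fixes \<alpha> :: real and f :: "complex \<Rightarrow> complex"
  assumes "0 < \<alpha>" and "\<alpha> \<le> 1" and "f \<in> dirichlet_space"
  shows "((\<lambda>t. dirichlet_norm (\<lambda>z. rotation t f z - f z)) \<in> O[at 0](\<lambda>t. \<bar>t\<bar> powr \<alpha>)
            \<longleftrightarrow> (\<lambda>r. dilation_norm r (deriv f)) \<in> O[at_left 1](\<lambda>r. (1 - r) powr (\<alpha> - 1)))
       \<and> ((\<lambda>r. dilation_norm r (deriv f)) \<in> O[at_left 1](\<lambda>r. (1 - r) powr (\<alpha> - 1))
            \<longleftrightarrow> (\<lambda>r. dirichlet_norm (\<lambda>z. dilation r f z - f z)) \<in> O[at_left 1](\<lambda>r. (1 - r) powr \<alpha>))"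
proof -
  obtain a :: "nat \<Rightarrow> complex"
    where f: "\<And>z. z \<in> unit_disc \<Longrightarrow> (\<lambda>n. a n * z ^ n) sums f z"
      and d: "\<And>z. z \<in> unit_disc \<Longrightarrow> (\<lambda>n. diffs a n * z ^ n) sums deriv f z"
      and sm: "summable (\<lambda>n. n * (cmod (a n))\<^sup>2)"
    using dirichlet_space_power_series[OF assms(3)] by blast
  define c where "c = (\<lambda>n. n * (cmod (a n))\<^sup>2)"
  have c: "0 \<le> c n" "summable c" for n using sm by (simp_all add: c_def)
  define E where "E = (\<lambda>w. (\<lambda>\<delta>. sqrt (\<Sum>n. w \<delta> n * c n)) \<in> O[at_right 0](\<lambda>\<delta>. \<delta> powr \<alpha>))"
  have E: "E w \<longleftrightarrow> E v" if "saturating_weight w" "saturating_weight v" for w v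
    unfolding E_def using saturating_weight_transfer[OF _ _ c(1) c(2) assms(1)] that by blast
  have pos: "eventually (\<lambda>\<delta>. 0 < \<delta> \<and> \<delta> < 1) (at_right (0::real))"
    unfolding eventually_at_right_field by (intro exI[of _ 1]) auto

  let ?rot = "\<lambda>\<delta> n. (cmod (exp (\<i> * of_real \<delta>) ^ n - 1))\<^sup>2"
  let ?dil = "\<lambda>(\<delta>::real) n. ((1 - \<delta>) ^ n - 1)\<^sup>2"

  have "(\<lambda>t. dirichlet_norm (\<lambda>z. rotation t f z - f z)) \<in> O[at 0](\<lambda>t. \<bar>t\<bar> powr \<alpha>) \<longleftrightarrow> E ?rot"
    unfolding E_def
  proof (rule bigo_at_0_abs_iff)
    fix t :: real
    have "dirichlet_norm (\<lambda>z. rotation t f z - f z) = sqrt (\<Sum>n. ?rot t n * c n)"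
      unfolding rotation_def c_def by (rule dirichlet_norm_multiplier_difference[OF f sm]) simp_all
    moreover have "?rot t n = ?rot \<bar>t\<bar> n" for n
    proof (cases "0 \<le> t")
      case False
      have "exp (\<i> * of_real \<bar>t\<bar>) ^ n - 1 = cnj (exp (\<i> * of_real t) ^ n - 1)"
        using False by (simp add: exp_cnj)
      then show ?thesis by (simp only: complex_mod_cnj)
    qed simp
    ultimately show "dirichlet_norm (\<lambda>z. rotation t f z - f z) = sqrt (\<Sum>n. ?rot \<bar>t\<bar> n * c n)"
      by presburger
  qed
  moreover have "(\<lambda>r. dirichlet_norm (\<lambda>z. dilation r f z - f z)) \<in> O[at_left 1](\<lambda>r. (1 - r) powr \<alpha>) \<longleftrightarrow> E ?dil"
    unfolding E_def bigo_at_left_1_iff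
  proof (rule landau_o.big.cong_ex)
    show "eventually (\<lambda>\<delta>. dirichlet_norm (\<lambda>z. dilation (1 - \<delta>) f z - f z) = sqrt (\<Sum>n. ?dil \<delta> n * c n)) (at_right 0)"
      using pos
    proof eventually_elim
      case (elim \<delta>)
      have "?dil \<delta> n = (cmod (of_real (1 - \<delta>) ^ n - 1))\<^sup>2" for n
      proof -
        have "cmod (of_real (1 - \<delta>) ^ n - 1) = \<bar>(1 - \<delta>) ^ n - 1\<bar>"
          by (metis norm_of_real of_real_1 of_real_diff of_real_power)
        then show ?thesis by simp
      qed
      moreover have "cmod (of_real (1 - \<delta>)) \<le> 1"
        unfolding norm_of_real using elim by simp
      ultimately show ?case
        unfolding dilation_def c_def using dirichlet_norm_multiplier_difference[OF f sm] by presburger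
    qed
  qed simp
  moreover have "(\<lambda>r. dilation_norm r (deriv f)) \<in> O[at_left 1](\<lambda>r. (1 - r) powr (\<alpha> - 1)) \<longleftrightarrow> E dilated_derivative_weight"
  proof -
    have "(\<lambda>r. dilation_norm r (deriv f)) \<in> O[at_left 1](\<lambda>r. (1 - r) powr (\<alpha> - 1)) \<longleftrightarrow>
        (\<lambda>\<delta>. \<delta> * dilation_norm (1 - \<delta>) (deriv f)) \<in> O[at_right 0](\<lambda>\<delta>. \<delta> * (1 - (1 - \<delta>)) powr (\<alpha> - 1))"
      unfolding bigo_at_left_1_iff
      by (rule landau_o.big.mult_cancel_left[symmetric])
         (use pos in \<open>auto elim: eventually_mono\<close>)
    also have "\<dots> \<longleftrightarrow> E dilated_derivative_weight"
      unfolding E_def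
    proof (rule landau_o.big.cong_ex)
      show "eventually (\<lambda>\<delta>. \<delta> * dilation_norm (1 - \<delta>) (deriv f) = sqrt (\<Sum>n. dilated_derivative_weight \<delta> n * c n)) (at_right 0)"
        using pos unfolding c_def
        by eventually_elim (rule dilation_norm_deriv[OF d sm], auto)
      show "eventually (\<lambda>\<delta>. \<delta> * (1 - (1 - \<delta>)) powr (\<alpha> - 1) = \<delta> powr \<alpha>) (at_right 0)"
        using pos by eventually_elim (simp add: powr_diff)
    qed
    finally show ?thesis .
  qed
  ultimately show ?thesis
    using E[OF saturating_weight_rotation saturating_weight_dilated_derivative]
      E[OF saturating_weight_dilated_derivative saturating_weight_dilation] by blast
qed

end
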